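(* Call a permutation $\pi$ triangular if $\pi_1=1$ and its consecutive-minima polygon $P_\pi$ has at most $3$ faces. For each $n\ge 0$, the number of triangular permutations of length $n+2$ is $\binom{2n}{n}$. Moreover, letting $t_{n;1,a}$ denote the number of triangular permutations $\pi$ of length $n$ with $\pi_1=1$ and $\pi_2=a$, the generating function $t(v;x)=\sum_{n\geq 2}\sum_{a=2}^{n}t_{n;1,a}v^{a-2}x^{n}$ is given by $$t(v;x)=\frac{x^{2}(1-v)(1-xv)^{2}}{(1-2xv)(1-v+xv^{2})}+\frac{x^{3}}{1-v+xv^{2}}\cdot \frac{1}{\sqrt{1-4x}}.$$
   Context: A permutation $\pi=\pi_1\pi_2\cdots\pi_n$ of $[n]=\{1,\dots,n\}$ is identified with the set of grid points $L_\pi=\{(i,\pi_i): 1\le i\le n\}$. A point $(i,j)\in L_\pi$ is a left-right minimum if there is no $(i',j')\in L_\pi$ with $i'<i$ and $j'<j$; it is a right-left minimum if there is no $(i',j')\in L_\pi$ with $i'>i$ and $j'<j$; it is a source if $i=1$, or $i=n$, or it is neither a left-right minimum nor a right-left minimum. Two points $(i,j),(i',j')$ of one of these three sets are consecutive (in that set) if no point $(a,b)$ of the same set satisfies $i<a<i'$ or $i'<a<i$. The consecutive-minima polygon $P_\pi$ has vertex set $L_\pi$, and two vertices $(i,j),(i',j')$ with $i<i'$ are joined by an edge if they are consecutive left-right minima, or consecutive right-left minima, or consecutive sources. An edge $((i,j),(i',j'))$ with $i<i'$ is increasing if $j<j'$ and decreasing if $j>j'$. A path is a sequence of edges $(a_0,a_1),(a_1,a_2),\dots,(a_{s-1},a_s)$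 of $P_\pi$. A face of $P_\pi$ is either a maximal path of increasing edges or a maximal path of decreasing edges; the number of faces of $P_\pi$ is the number of such maximal paths. *)

theory Defs
  imports
    "HOL-Library.Sublist"
    "HOL-Combinatorics.Permutations"
    "HOL-Computational_Algebra.Formal_Laurent_Series"
begin

type_synonym point = "nat \<times> nat"
type_synonym edge = "point \<times> point"

definition perm_points :: "nat \<Rightarrow> (nat \<Rightarrow> nat) \<Rightarrow> point set" where
  "perm_points n \<pi> = {(i, \<pi> i) | i. 1 \<le> i \<and> i \<le> n}"

definition lr_minima :: "nat \<Rightarrow> (nat \<Rightarrow> nat) \<Rightarrow> point set" where
  "lr_minima n \<pi> = {(i, j) \<in> perm_points n \<pi>.
     \<not> (\<exists>(i', j') \<in> perm_points n \<pi>. i' < i \<and> j' < j)}"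

definition rl_minima :: "nat \<Rightarrow> (nat \<Rightarrow> nat) \<Rightarrow> point set" where
  "rl_minima n \<pi> = {(i, j) \<in> perm_points n \<pi>.
     \<not> (\<exists>(i', j') \<in> perm_points n \<pi>. i' > i \<and> j' < j)}"

definition sources :: "nat \<Rightarrow> (nat \<Rightarrow> nat) \<Rightarrow> point set" where
  "sources n \<pi> = {(i, j) \<in> perm_points n \<pi>.
     i = 1 \<or> i = n \<or> ((i, j) \<notin> lr_minima n \<pi> \<and> (i, j) \<notin> rl_minima n \<pi>)}"

definition consecutive_in :: "point set \<Rightarrow> point \<Rightarrow> point \<Rightarrow> bool" where
  "consecutive_in S p q \<longleftrightarrow> p \<in> S \<and> q \<in> S \<and>
     \<not> (\<exists>(a, b) \<in> S. (fst p < a \<and> a < fst q) \<or> (fst q < a \<and> a < fst p))"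

definition polygon_edges :: "nat \<Rightarrow> (nat \<Rightarrow> nat) \<Rightarrow> edge set" where
  "polygon_edges n \<pi> = {(p, q). fst p < fst q \<and>
     (consecutive_in (lr_minima n \<pi>) p q \<or>
      consecutive_in (rl_minima n \<pi>) p q \<or>
      consecutive_in (sources n \<pi>) p q)}"

definition increasing_edges :: "nat \<Rightarrow> (nat \<Rightarrow> nat) \<Rightarrow> edge set" where
  "increasing_edges n \<pi> = {(p, q) \<in> polygon_edges n \<pi>. snd p < snd q}"

definition decreasing_edges :: "nat \<Rightarrow> (nat \<Rightarrow> nat) \<Rightarrow> edge set" where
  "decreasing_edges n \<pi> = {(p, q) \<in> polygon_edges n \<pi>. snd p > snd q}"

text \<open>
  Since edges are stored with the left endpoint first, paths run from left to right: two increasing edges that leave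
  the leftmost point of the polygon, or that enter its rightmost point, belong to different paths.
\<close>

definition is_path :: "edge set \<Rightarrow> edge list \<Rightarrow> bool" where
  "is_path E es \<longleftrightarrow> es \<noteq> [] \<and> set es \<subseteq> E \<and> successively (\<lambda>e f. snd e = fst f) es"

definition maximal_path :: "edge set \<Rightarrow> edge list \<Rightarrow> bool" where
  "maximal_path E es \<longleftrightarrow> is_path E es \<and> (\<forall>es'. is_path E es' \<and> sublist es es' \<longrightarrow> es' = es)"

definition faces :: "nat \<Rightarrow> (nat \<Rightarrow> nat) \<Rightarrow> edge list set" where
  "faces n \<pi> = {es. maximal_path (increasing_edges n \<pi>) es \<or>
                    maximal_path (decreasing_edges n \<pi>) es}"

definition triangular :: "nat \<Rightarrow> (nat \<Rightarrow> nat) \<Rightarrow> bool" where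
  "triangular n \<pi> \<longleftrightarrow> \<pi> permutes {1..n} \<and> \<pi> 1 = 1 \<and> card (faces n \<pi>) \<le> 3"

definition tri_count :: "nat \<Rightarrow> nat \<Rightarrow> nat" where
  "tri_count n a = card {\<pi>. triangular n \<pi> \<and> \<pi> 1 = 1 \<and> \<pi> 2 = a}"

text \<open>
  Bivariate series are power series in \<open>x\<close> whose coefficients are formal Laurent series in \<open>v\<close>.
  This ring contains the power series in \<open>v\<close> and \<open>x\<close>, and as the coefficients form a field,
  the division of power series and \<^const>\<open>fps_radical\<close> apply to it directly.
\<close>

definition var_v :: "rat fls fps" where
  "var_v = fps_const fls_X"

definition var_x :: "rat fls fps" where
  "var_x = fps_X"

definition tri_gf :: "rat fls fps" where
  "tri_gf = Abs_fps (\<lambda>n. if n \<ge> 2 then \<Sum>a=2..n. of_nat (tri_count n a) * fls_X ^ (a - 2) else 0)"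

text \<open>
  The square root with constant term \<open>1\<close> of a series with constant term \<open>1\<close>; the first argument
  of \<^const>\<open>fps_radical\<close> selects the root of the constant term.
\<close>

definition fps_sqrt1 :: "'a::field_char_0 fps \<Rightarrow> 'a fps" where
  "fps_sqrt1 f = fps_radical (\<lambda>_ _. 1) 2 f"

end

theory Submission
  imports Defs
begin

text \<open>
  If \<open>\<pi> 1 = 1\<close>, then \<open>(1, 1)\<close> is the only left-right minimum and the polygon is the union of two chains from
  \<open>(1, 1)\<close> to \<open>(n, \<pi> n)\<close>: the right-left minima, which form one increasing face, and the sources. Hence there are
  at most three faces iff the source chain changes direction at most once, that is, iff it has no valley.
  Since the largest of the entries behind a given position is always a source, this says that no entry
  is followed both by a smaller and by a larger one while being preceded by a larger one.

  Call an entry with a smaller and a larger entry behind it a blocker. Building the word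
  \<open>\<pi> 2 - 1, \<dots>, \<pi> n - 1\<close> from right to left, a new first entry of relative rank \<open>a\<close> is allowed iff no blocker is below
  \<open>a\<close>, and it becomes a blocker itself unless it is the least or the greatest entry. So the number \<open>F m c\<close> of
  admissible words of length \<open>m\<close> with all blockers \<open>\<ge> c\<close> satisfies \<open>F (m+1) c = F (m+1) (c+1) + F m (c-1)\<close> for
  \<open>2 \<le> c \<le> m\<close>, with \<open>F m m = F m (m+1) = 2 ^ (m-1)\<close>. The solution is a sum of consecutive binomial coefficients of
  one row, which is central for \<open>c = 1\<close>; and the recurrence is the coefficientwise form of the kernel equation
  for the generating function, as \<open>F (n-2) (a-1)\<close> triangular permutations have \<open>\<pi> 2 = a\<close>.
\<close>

section \<open>Maximal paths\<close>

text \<open>These are the possible first edges of maximal paths; counting them replaces counting the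
  paths.\<close>

definition start_edges :: "edge set \<Rightarrow> edge set" where
  "start_edges E = {e \<in> E. \<forall>f\<in>E. snd f \<noteq> fst e}"

lemma is_path_Cons:
  "is_path E (e # es) \<longleftrightarrow> e \<in> E \<and> (es = [] \<or> is_path E es \<and> snd e = fst (hd es))"
  by (cases es) (auto simp: is_path_def)

lemma is_path_ne: "is_path E es \<Longrightarrow> es \<noteq> []"
  by (simp add: is_path_def)

lemma is_path_appendD:
  assumes "is_path E (ps @ es)" "ps \<noteq> []" "es \<noteq> []"
  shows "last ps \<in> E" "snd (last ps) = fst (hd es)"
  using assms by (auto simp: is_path_def successively_append_iff)

text \<open>Abscissas strictly increase along a path, so no edge repeats. The bound is what provides
  a longest path below.\<close>

lemma is_path_length_le:
  assumes "is_path E es" "finite E" "\<And>e. e \<in> E \<Longrightarrow> fst (fst e) < fst (snd e)"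
  shows "length es \<le> card E"
proof -
  have "successively (\<lambda>e f. fst (fst e) < fst (fst f)) es"
    using assms(1) unfolding is_path_def
    using successively_mono[of "\<lambda>e f. snd e = fst f" es "\<lambda>e f. fst (fst e) < fst (fst f)"] assms(3)
    by (metis subsetD)
  then have "sorted_wrt (\<lambda>e f. fst (fst e) < fst (fst f)) es"
    by (subst (asm) successively_conv_sorted_wrt) (auto simp: transp_def)
  then have "distinct es"
    by (induction es) auto
  then show ?thesis
    using assms(1,2) by (metis card_mono distinct_card is_path_def)
qed

text \<open>With unique successors, a path is determined by its first edge and its length.
  Uniqueness is asked only behind an edge \<open>e\<close>, so several edges may leave a vertex that
  no edge enters.\<close>

lemma is_path_prefix:
  assumes "\<And>e f g. e \<in> E \<Longrightarrow> f \<in> E \<Longrightarrow> g \<in> E \<Longrightarrow> snd e = fst f \<Longrightarrow> snd e = fst g \<Longrightarrow> f = g"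
  shows "is_path E es \<Longrightarrow> is_path E fs \<Longrightarrow> hd es = hd fs \<Longrightarrow> prefix es fs \<or> prefix fs es"
proof (induction es arbitrary: fs)
  case (Cons e es)
  then obtain gs where fs: "fs = e # gs"
    by (metis is_path_ne list.collapse list.sel(1))
  show ?case
  proof (cases "es = [] \<or> gs = []")
    case False
    then have "hd es \<in> E" "hd gs \<in> E" "e \<in> E" "snd e = fst (hd es)" "snd e = fst (hd gs)"
      "is_path E es" "is_path E gs"
      using Cons.prems fs by (auto simp: is_path_Cons) (auto simp: is_path_def)
    then show ?thesis using Cons.IH[of gs] assms[of e "hd es" "hd gs"] fs by simp
  qed (auto simp: fs)
qed (simp add: is_path_def)

text \<open>Two maximal paths with the same head are prefix-comparable, hence equal. A head with a
  preceding edge would allow an extension to the left; conversely, a longest path from a start edge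
  extends in neither direction.\<close>

lemma bij_betw_hd_maximal_paths:
  assumes fin: "finite E"
    and ranked: "\<And>e. e \<in> E \<Longrightarrow> fst (fst e) < fst (snd e)"
    and uniq: "\<And>e f g. e \<in> E \<Longrightarrow> f \<in> E \<Longrightarrow> g \<in> E \<Longrightarrow> snd e = fst f \<Longrightarrow> snd e = fst g \<Longrightarrow> f = g"
  shows "bij_betw hd {es. maximal_path E es} (start_edges E)"
  unfolding bij_betw_def
proof (intro conjI equalityI subsetI)
  show "inj_on hd {es. maximal_path E es}"
  proof (rule inj_onI)
    fix es fs assume "es \<in> {es. maximal_path E es}" "fs \<in> {es. maximal_path E es}" "hd es = hd fs"
    then have m: "maximal_path E es" "maximal_path E fs" "hd es = hd fs" by auto
    then have "prefix es fs \<or> prefix fs es"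
    proof (intro is_path_prefix)
      show "f = g" if "e \<in> E" "f \<in> E" "g \<in> E" "snd e = fst f" "snd e = fst g" for e f g
        using that by (rule uniq)
    qed (simp_all add: maximal_path_def)
    then show "es = fs"
      using m unfolding maximal_path_def by (auto dest!: prefix_imp_sublist)
  qed
next
  fix e assume "e \<in> hd ` {es. maximal_path E es}"
  then obtain es where es: "maximal_path E es" "e = hd es" by blast
  then have p: "is_path E es" by (simp add: maximal_path_def)
  have "snd f \<noteq> fst e" if "f \<in> E" for f
  proof
    assume "snd f = fst e"
    then have "is_path E (f # es)" using p es that by (simp add: is_path_Cons)
    then have "f # es = es" using es unfolding maximal_path_def by (metis sublist_Cons_right sublist_order.order_refl)
    then show False by simp
  qed
  moreover have "e \<in> E" using p es by (auto simp: is_path_def)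
  ultimately show "e \<in> start_edges E" by (simp add: start_edges_def)
next
  fix e assume e: "e \<in> start_edges E"
  \<comment> \<open>A longest member of \<open>L\<close> will be the maximal path with head
    \<open>e\<close>.\<close>
  define L where "L = {es. is_path E es \<and> hd es = e}"
  have "[e] \<in> L" using e by (simp add: L_def is_path_def start_edges_def)
  moreover have "\<forall>es. es \<in> L \<longrightarrow> length es \<le> card E"
    using is_path_length_le[OF _ fin ranked] by (auto simp: L_def)
  ultimately have "\<exists>es. es \<in> L \<and> (\<forall>fs. fs \<in> L \<longrightarrow> length fs \<le> length es)"
    using ex_has_greatest_nat[of "\<lambda>es. es \<in> L" "[e]" length "Suc (card E)"] by (auto simp: less_Suc_eq_le)
  then obtain es where es: "es \<in> L" "\<And>fs. fs \<in> L \<Longrightarrow> length fs \<le> length es"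
    by blast
  have "es' = es" if es': "is_path E es'" "sublist es es'" for es'
  proof -
    obtain ps ss where d: "es' = ps @ es @ ss" using es' by (auto simp: sublist_def)
    have ne: "es \<noteq> []" using es is_path_ne by (auto simp: L_def)
    \<comment> \<open>The last edge of a nonempty \<open>ps\<close> would end where the start edge
      \<open>e\<close> begins.\<close>
    have "ps = []"
    proof (rule ccontr)
      assume "ps \<noteq> []"
      then have "last ps \<in> E" "snd (last ps) = fst e"
        using is_path_appendD[of E ps "es @ ss"] es' es d ne by (auto simp: L_def)
      then show False using e by (auto simp: start_edges_def)
    qed
    then have "es' \<in> L" using es es' d ne by (simp add: L_def)
    then have "length es' \<le> length es" by (rule es(2))
    then show ?thesis using d \<open>ps = []\<close> by simp
  qed
  then have "maximal_path E es" using es by (simp add: L_def maximal_path_def)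
  then show "e \<in> hd ` {es. maximal_path E es}" using es by (auto simp: L_def)
qed

section \<open>Turns of a chain\<close>

definition adjacent_in :: "nat set \<Rightarrow> nat \<Rightarrow> nat \<Rightarrow> bool" where
  "adjacent_in A i j \<longleftrightarrow> i \<in> A \<and> j \<in> A \<and> i < j \<and> \<not> (\<exists>a\<in>A. i < a \<and> a < j)"

lemma adjacent_in_pred:
  assumes "finite A" "a \<in> A" "i \<in> A" "a < i"
  obtains h where "adjacent_in A h i"
proof -
  define h where "h = Max {b \<in> A. b < i}"
  have "h \<in> {b \<in> A. b < i}" unfolding h_def using assms by (intro Max_in) auto
  moreover have "b \<le> h" if "b \<in> A" "b < i" for b
    unfolding h_def using assms that by (intro Max_ge) auto
  ultimately have "adjacent_in A h i"
    using assms by (auto simp: adjacent_in_def leD)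
  then show thesis by (rule that)
qed

lemma adjacent_in_succ:
  assumes "finite A" "a \<in> A" "i \<in> A" "i < a"
  obtains j where "adjacent_in A i j"
proof -
  define j where "j = Min {b \<in> A. i < b}"
  have "j \<in> {b \<in> A. i < b}" unfolding j_def using assms by (intro Min_in) auto
  moreover have "j \<le> b" if "b \<in> A" "i < b" for b
    unfolding j_def using assms that by (intro Min_le) auto
  ultimately have "adjacent_in A i j"
    using assms by (auto simp: adjacent_in_def leD)
  then show thesis by (rule that)
qed

lemma adjacent_in_unique_left: "adjacent_in A h i \<Longrightarrow> adjacent_in A h' i \<Longrightarrow> h = h'"
  unfolding adjacent_in_def by (metis linorder_neqE_nat)

lemma adjacent_in_unique_right: "adjacent_in A i j \<Longrightarrow> adjacent_in A i j' \<Longrightarrow> j = j'"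
  unfolding adjacent_in_def by (metis linorder_neqE_nat)

definition turns :: "nat set \<Rightarrow> (nat \<Rightarrow> nat) \<Rightarrow> nat set" where
  "turns S f = {i. \<exists>h j. adjacent_in S h i \<and> adjacent_in S i j \<and> (f h < f i) \<noteq> (f i < f j)}"

text \<open>A maximum over the window from \<open>a\<close> to \<open>c\<close> cannot sit at an
  end, as \<open>b\<close> beats both ends. Since \<open>a\<close> and \<open>c\<close> belong to
  \<open>S\<close>, the neighbours of an interior point stay in the window.\<close>

lemma interior_argmax:
  fixes g :: "nat \<Rightarrow> nat"
  assumes S: "finite S" "a \<in> S" "b \<in> S" "c \<in> S" "a < b" "b < c"
    and g: "g a < g b" "g c < g b"
  obtains i where "a < i" "i < c" "i \<in> S"
    "\<And>h j. adjacent_in S h i \<Longrightarrow> adjacent_in S i j \<Longrightarrow> g h \<le> g i \<and> g j \<le> g i"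
proof -
  let ?B = "{x \<in> S. a \<le> x \<and> x \<le> c}"
  have fB: "finite (g ` ?B)" "?B \<noteq> {}" using S by auto
  then have "Max (g ` ?B) \<in> g ` ?B" by (intro Max_in) auto
  then obtain i where i: "i \<in> ?B" "g i = Max (g ` ?B)" by auto
  have m: "g x \<le> g i" if "x \<in> ?B" for x using that i fB by (auto intro!: Max_ge)
  have "g b \<le> g i" using m S by simp
  then have "i \<noteq> a" "i \<noteq> c" using g by auto
  then have ac: "a < i" "i < c" "i \<in> S" using i by auto
  have "g h \<le> g i \<and> g j \<le> g i" if "adjacent_in S h i" "adjacent_in S i j" for h j
  proof -
    have "a \<le> h" "h < i" "h \<in> S" "j \<le> c" "i < j" "j \<in> S"
      using that ac S by (auto simp: adjacent_in_def not_less[symmetric])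
    then show ?thesis using ac m by simp
  qed
  then show thesis using ac that by blast
qed

text \<open>The chain starts at its minimum, so a descent to a valley forces a peak before it, and
  peak and valley are two turns. Without a valley every turn is a peak, and two peaks would enclose
  a valley.\<close>

lemma card_turns_le_1_iff:
  fixes f :: "nat \<Rightarrow> nat"
  assumes fin: "finite S" and inj: "inj_on f S" and p: "p \<in> S"
    and pmin: "\<And>x. x \<in> S \<Longrightarrow> x \<noteq> p \<Longrightarrow> p < x \<and> f p < f x"
  shows "card (turns S f) \<le> 1 \<longleftrightarrow>
    \<not> (\<exists>i\<in>S. \<exists>j\<in>S. \<exists>k\<in>S. i < j \<and> j < k \<and> f j < f i \<and> f j < f k)"
    (is "_ \<longleftrightarrow> \<not> ?V")
proof
  assume c: "card (turns S f) \<le> 1"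
  show "\<not> ?V"
  proof
    assume ?V
    then obtain i j k where V: "i \<in> S" "j \<in> S" "k \<in> S" "i < j" "j < k" "f j < f i" "f j < f k" by blast
    have "i \<noteq> p" using pmin[of j] V by auto
    then have pi: "p < i" "f p < f i" using pmin[of i] V by auto
    have ft: "finite (turns S f)"
      by (rule finite_subset[OF _ fin]) (auto simp: turns_def adjacent_in_def)
    \<comment> \<open>\<open>u\<close> is a peak before \<open>j\<close>: the value at
      \<open>i\<close> exceeds those at \<open>p\<close> and \<open>j\<close>.\<close>
    obtain u where u: "p < u" "u < j" "u \<in> S"
      "\<And>h j. adjacent_in S h u \<Longrightarrow> adjacent_in S u j \<Longrightarrow> f h \<le> f u \<and> f j \<le> f u"
      using interior_argmax[of S p i j f] fin p V pi by metis
    \<comment> \<open>Subtraction from the upper bound \<open>M\<close> reverses the order of the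
      values on \<open>S\<close> without truncation, so the maximum lemma also yields a local
      minimum \<open>w\<close> between \<open>i\<close> and \<open>k\<close>.\<close>
    define M where "M = Max (f ` S)"
    have M: "f x \<le> M" if "x \<in> S" for x using that fin by (simp add: M_def)
    have "M - f i < M - f j" "M - f k < M - f j"
      using V M[OF V(1)] M[OF V(3)] by linarith+
    then obtain w where w: "i < w" "w < k" "w \<in> S"
      "\<And>h j. adjacent_in S h w \<Longrightarrow> adjacent_in S w j \<Longrightarrow> M - f h \<le> M - f w \<and> M - f j \<le> M - f w"
      using interior_argmax[of S i j k "\<lambda>x. M - f x"] fin V by metis
    obtain h1 j1 where 1: "adjacent_in S h1 u" "adjacent_in S u j1"
      by (meson adjacent_in_pred[OF fin p u(3,1)] adjacent_in_succ[OF fin V(2) u(3,2)])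
    obtain h2 j2 where 2: "adjacent_in S h2 w" "adjacent_in S w j2"
      by (meson adjacent_in_pred[OF fin V(1) w(3,1)] adjacent_in_succ[OF fin V(3) w(3,2)])
    have "h1 \<in> S" "h1 \<noteq> u" "j1 \<in> S" "j1 \<noteq> u" "h2 \<in> S" "h2 \<noteq> w" "j2 \<in> S" "j2 \<noteq> w"
      using 1 2 by (auto simp: adjacent_in_def)
    then have ne: "f h1 \<noteq> f u" "f j1 \<noteq> f u" "f h2 \<noteq> f w" "f j2 \<noteq> f w"
      using inj u w by (auto simp: inj_on_def)
    have pk: "f h1 < f u" "f j1 < f u" using u(4)[OF 1] ne by auto
    have vl: "f w < f h2" "f w < f j2"
      using w(4)[OF 2] ne M[OF \<open>h2 \<in> S\<close>] M[OF \<open>j2 \<in> S\<close>] M[OF \<open>w \<in> S\<close>] by auto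
    have "(f h1 < f u) \<noteq> (f u < f j1)" "(f h2 < f w) \<noteq> (f w < f j2)" using pk vl by auto
    then have "u \<in> turns S f" "w \<in> turns S f" using 1 2 unfolding turns_def by blast+
    moreover have "u \<noteq> w"
      using 1 2 adjacent_in_unique_left[of S h1 u h2] pk vl by auto
    ultimately show False using c ft by (metis card_le_Suc0_iff_eq One_nat_def)
  qed
next
  assume nV: "\<not> ?V"
  have peak: "\<exists>h j. adjacent_in S h i \<and> adjacent_in S i j \<and> f h < f i \<and> f j < f i"
    if t: "i \<in> turns S f" for i
  proof -
    obtain h j where hj: "adjacent_in S h i" "adjacent_in S i j" "(f h < f i) \<noteq> (f i < f j)"
      using t by (auto simp: turns_def)
    then have S: "h \<in> S" "i \<in> S" "j \<in> S" "h < i" "i < j" by (auto simp: adjacent_in_def)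
    have "f h \<noteq> f i" "f j \<noteq> f i"
      using inj S by (auto dest: inj_onD)
    moreover have "\<not> (f i < f h \<and> f i < f j)"
      using nV S by blast
    ultimately have "f h < f i" "f j < f i" using hj(3) by linarith+
    then show ?thesis using hj by blast
  qed
  \<comment> \<open>The neighbour of the lower peak on the side facing the other peak lies below
    both peaks, hence is a valley.\<close>
  have no2: False if t: "i \<in> turns S f" "i' \<in> turns S f" "i < i'" for i i'
  proof -
    obtain j where j: "adjacent_in S i j" "f j < f i" using peak[OF t(1)] by blast
    obtain h where h: "adjacent_in S h i'" "f h < f i'" using peak[OF t(2)] by blast
    have S: "i \<in> S" "j \<in> S" "h \<in> S" "i' \<in> S" "i < j" "h < i'" "j \<le> i'" "i \<le> h"
      using j h t(3) by (auto simp: adjacent_in_def not_less[symmetric])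
    show False
    proof (cases "f i < f i'")
      case True
      then have "j \<noteq> i'" "f j < f i'" using j by auto
      then have "j < i'" using S by simp
      then show False using nV S j \<open>f j < f i'\<close> by blast
    next
      case False
      then have "i \<noteq> h" "f h < f i" using h by auto
      then have "i < h" using S by simp
      then show False using nV S h \<open>f h < f i\<close> by blast
    qed
  qed
  have "i = i'" if "i \<in> turns S f" "i' \<in> turns S f" for i i'
    using no2 that by (metis linorder_neqE_nat)
  then show "card (turns S f) \<le> 1"
    by (cases "finite (turns S f)") (auto simp: card_le_Suc0_iff_eq)
qed

section \<open>Faces of the polygon\<close>

locale anchored_permutation =
  fixes n :: nat and \<pi> :: "nat \<Rightarrow> nat"
  assumes perm: "\<pi> permutes {1..n}" and fixes_one: "\<pi> 1 = 1" and two_le: "2 \<le> n"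
begin

text \<open>As \<pi> 1 = 1, a position strictly between 1 and \<open>n\<close> is never a left-right
  minimum, so it is a source iff a smaller entry follows it.\<close>

definition source_pos :: "nat set" where
  "source_pos = {i\<in>{1..n}. i = 1 \<or> i = n \<or> (\<exists>k\<in>{i<..n}. \<pi> k < \<pi> i)}"

definition rlmin_pos :: "nat set" where
  "rlmin_pos = {i\<in>{1..n}. \<forall>k\<in>{i<..n}. \<pi> i < \<pi> k}"

abbreviation pt :: "nat \<Rightarrow> point" where
  "pt i \<equiv> (i, \<pi> i)"

lemma perm_eq_iff: "\<pi> i = \<pi> j \<longleftrightarrow> i = j"
  using permutes_inj[OF perm] by (auto simp: inj_def)

lemma one_less: "1 < i \<Longrightarrow> i \<le> n \<Longrightarrow> 1 < \<pi> i"
  using permutes_in_image[OF perm, of i] perm_eq_iff[of i 1] fixes_one by (auto simp: le_neq_implies_less)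

lemma finite_pos [simp]: "finite source_pos" "finite rlmin_pos"
  by (simp_all add: source_pos_def rlmin_pos_def)

lemma ends_in_pos [simp]:
  "Suc 0 \<in> source_pos" "n \<in> source_pos" "Suc 0 \<in> rlmin_pos" "n \<in> rlmin_pos"
  using two_le one_less fixes_one by (auto simp: source_pos_def rlmin_pos_def)

lemma pos_bounds:
  "i \<in> source_pos \<Longrightarrow> 1 \<le> i \<and> i \<le> n" "i \<in> rlmin_pos \<Longrightarrow> 1 \<le> i \<and> i \<le> n"
  by (auto simp: source_pos_def rlmin_pos_def)

text \<open>Together with \<open>pos_cover\<close> this puts each interior position on exactly one
  of the two chains.\<close>

lemma pos_disjoint: "i \<in> source_pos \<Longrightarrow> i \<in> rlmin_pos \<Longrightarrow> i = 1 \<or> i = n"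
  by (auto simp: source_pos_def rlmin_pos_def dest: less_asym)

lemma pos_cover: "1 \<le> i \<Longrightarrow> i \<le> n \<Longrightarrow> i \<in> source_pos \<or> i \<in> rlmin_pos"
proof (rule disjCI)
  assume i: "1 \<le> i" "i \<le> n" "i \<notin> rlmin_pos"
  then obtain k where k: "k \<in> {i<..n}" "\<not> \<pi> i < \<pi> k" by (auto simp: rlmin_pos_def)
  then have "\<pi> k < \<pi> i" using perm_eq_iff[of i k] by auto
  then show "i \<in> source_pos" using i k by (auto simp: source_pos_def)
qed

section \<open>The three point sets in terms of positions\<close>

lemma perm_points_eq: "perm_points n \<pi> = pt ` {1..n}"
  by (auto simp: perm_points_def)

lemma rl_minima_eq: "rl_minima n \<pi> = pt ` rlmin_pos"
proof -
  have "(\<forall>k\<in>{i<..n}. \<pi> i < \<pi> k) \<longleftrightarrow> \<not> (\<exists>k\<in>{1..n}. i < k \<and> \<pi> k < \<pi> i)" if "1 \<le> i" for i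
  proof -
    have "\<pi> i < \<pi> k \<longleftrightarrow> \<not> \<pi> k < \<pi> i" if "i < k" for k
      using perm_eq_iff[of i k] that by linarith
    then show ?thesis using that by force
  qed
  then show ?thesis
    unfolding rl_minima_def perm_points_eq rlmin_pos_def by (auto simp: image_iff)
qed

text \<open>The point (1, 1) lies to the left of and below all others; so the left-right minima
  contribute no edge.\<close>

lemma lr_minima_eq: "lr_minima n \<pi> = {pt 1}"
proof -
  have "(\<exists>k\<in>{1..n}. k < i \<and> \<pi> k < \<pi> i) \<longleftrightarrow> i \<noteq> 1" if "1 \<le> i" "i \<le> n" for i
    using that one_less[of i] fixes_one by (auto intro!: bexI[of _ 1])
  then have "{i\<in>{1..n}. \<not> (\<exists>k\<in>{1..n}. k < i \<and> \<pi> k < \<pi> i)} = {1}"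
    using two_le by auto
  moreover have "lr_minima n \<pi> = pt ` {i\<in>{1..n}. \<not> (\<exists>k\<in>{1..n}. k < i \<and> \<pi> k < \<pi> i)}"
    unfolding lr_minima_def perm_points_eq by auto
  ultimately show ?thesis by simp
qed

lemma sources_eq: "sources n \<pi> = pt ` source_pos"
proof -
  have lr: "pt i \<in> lr_minima n \<pi> \<longleftrightarrow> i = 1" for i
    by (auto simp: lr_minima_eq)
  have rl: "pt i \<in> rl_minima n \<pi> \<longleftrightarrow> i \<in> rlmin_pos" for i
    by (auto simp: rl_minima_eq)
  have "sources n \<pi> = pt ` {i\<in>{1..n}. i = 1 \<or> i = n \<or> (pt i \<notin> lr_minima n \<pi> \<and> pt i \<notin> rl_minima n \<pi>)}"
    unfolding sources_def perm_points_eq by auto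
  also have "{i\<in>{1..n}. i = 1 \<or> i = n \<or> (pt i \<notin> lr_minima n \<pi> \<and> pt i \<notin> rl_minima n \<pi>)} = source_pos"
    unfolding lr rl
  proof (intro equalityI subsetI)
    fix i assume "i \<in> {i\<in>{1..n}. i = 1 \<or> i = n \<or> (i \<noteq> 1 \<and> i \<notin> rlmin_pos)}"
    then show "i \<in> source_pos" using pos_cover[of i] by auto
  next
    fix i assume "i \<in> source_pos"
    then show "i \<in> {i\<in>{1..n}. i = 1 \<or> i = n \<or> (i \<noteq> 1 \<and> i \<notin> rlmin_pos)}"
      using pos_bounds(1)[of i] pos_disjoint[of i] by auto
  qed
  finally show ?thesis .
qed

lemma consecutive_in_image_iff:
  "fst p < fst q \<and> consecutive_in (pt ` A) p q \<longleftrightarrow> (\<exists>i j. p = pt i \<and> q = pt j \<and> adjacent_in A i j)"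
  unfolding consecutive_in_def adjacent_in_def by fastforce

lemma polygon_edges_eq:
  "polygon_edges n \<pi> = {(pt i, pt j) | i j. adjacent_in rlmin_pos i j \<or> adjacent_in source_pos i j}"
proof -
  have "\<not> (fst p < fst q \<and> consecutive_in {pt 1} p q)" for p q
    by (auto simp: consecutive_in_def)
  then have "(p, q) \<in> polygon_edges n \<pi> \<longleftrightarrow> fst p < fst q \<and> consecutive_in (pt ` rlmin_pos) p q \<or>
      fst p < fst q \<and> consecutive_in (pt ` source_pos) p q" for p q
    unfolding polygon_edges_def lr_minima_eq rl_minima_eq sources_eq by blast
  then show ?thesis
    unfolding consecutive_in_image_iff by auto
qed

section \<open>Edges as pairs of positions\<close>

definition edge_at :: "nat \<Rightarrow> nat \<Rightarrow> bool" where
  "edge_at i j \<longleftrightarrow> adjacent_in rlmin_pos i j \<or> adjacent_in source_pos i j"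

lemma edge_at_less: "edge_at i j \<Longrightarrow> 1 \<le> i \<and> i < j \<and> j \<le> n"
  using pos_bounds by (auto simp: edge_at_def adjacent_in_def)

lemma increasing_edges_eq: "increasing_edges n \<pi> = {(pt i, pt j) | i j. edge_at i j \<and> \<pi> i < \<pi> j}"
  unfolding increasing_edges_def polygon_edges_eq edge_at_def by auto

lemma decreasing_edges_eq: "decreasing_edges n \<pi> = {(pt i, pt j) | i j. edge_at i j \<and> \<pi> j < \<pi> i}"
  unfolding decreasing_edges_def polygon_edges_eq edge_at_def by auto

lemma edge_at_interior:
  assumes "1 < i" "i < n"
  shows "i \<in> source_pos \<Longrightarrow> edge_at i j \<longleftrightarrow> adjacent_in source_pos i j"
    and "i \<in> source_pos \<Longrightarrow> edge_at h i \<longleftrightarrow> adjacent_in source_pos h i"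
    and "i \<in> rlmin_pos \<Longrightarrow> edge_at i j \<longleftrightarrow> adjacent_in rlmin_pos i j"
    and "i \<in> rlmin_pos \<Longrightarrow> edge_at h i \<longleftrightarrow> adjacent_in rlmin_pos h i"
  using pos_disjoint[of i] assms by (auto simp: edge_at_def adjacent_in_def)

text \<open>The chains share only the end positions, and nothing leaves \<open>n\<close>, so only
  position 1 can have two successors.\<close>

lemma edge_at_unique_right:
  assumes "1 < i" "edge_at i j" "edge_at i j'"
  shows "j = j'"
  using assms edge_at_interior[of i] edge_at_less[of i j] pos_cover[of i]
  by (metis adjacent_in_unique_right less_le_trans order_less_imp_le)

lemma finite_edges: "finite (increasing_edges n \<pi>)" "finite (decreasing_edges n \<pi>)"
proof -
  have "{(pt i, pt j) | i j. edge_at i j} \<subseteq> (pt ` {1..n}) \<times> (pt ` {1..n})"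
    using edge_at_less by force
  then have "finite {(pt i, pt j) | i j. edge_at i j}"
    by (rule finite_subset) auto
  moreover have "increasing_edges n \<pi> \<subseteq> {(pt i, pt j) | i j. edge_at i j}"
    "decreasing_edges n \<pi> \<subseteq> {(pt i, pt j) | i j. edge_at i j}"
    by (auto simp: increasing_edges_eq decreasing_edges_eq)
  ultimately show "finite (increasing_edges n \<pi>)" "finite (decreasing_edges n \<pi>)"
    by (auto intro: finite_subset)
qed

text \<open>Each face is identified with its first edge. No edge is both increasing and decreasing,
  so the two families of faces are disjoint and their counts add up.\<close>

lemma card_faces_eq:
  "card (faces n \<pi>) = card (start_edges (increasing_edges n \<pi>) \<union> start_edges (decreasing_edges n \<pi>))"
proof -
  let ?I = "increasing_edges n \<pi>" and ?D = "decreasing_edges n \<pi>"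
  have bij: "bij_betw hd {es. maximal_path E es} (start_edges E)" if E: "E = ?I \<or> E = ?D" for E
  proof (rule bij_betw_hd_maximal_paths)
    have form: "\<exists>i j. e = (pt i, pt j) \<and> edge_at i j" if "e \<in> E" for e
      using E that by (auto simp: increasing_edges_eq decreasing_edges_eq)
    show "finite E" using E finite_edges by auto
    show "fst (fst e) < fst (snd e)" if "e \<in> E" for e
      using form[OF that] edge_at_less by auto
    \<comment> \<open>The edge \<open>e\<close> ends at a position greater than 1, where no
      branching occurs; the two edges out of position 1 do no harm.\<close>
    show "f = g" if t: "e \<in> E" "f \<in> E" "g \<in> E" "snd e = fst f" "snd e = fst g" for e f g
    proof -
      obtain h i i' j i'' j' where *: "e = (pt h, pt i)" "f = (pt i', pt j)" "g = (pt i'', pt j')"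
        "edge_at h i" "edge_at i' j" "edge_at i'' j'"
        using form[OF t(1)] form[OF t(2)] form[OF t(3)] by blast
      then have "i' = i" "i'' = i" using t(4,5) by auto
      moreover have "1 < i" using edge_at_less[OF *(4)] by auto
      ultimately show ?thesis using * edge_at_unique_right by blast
    qed
  qed
  have disj: "?I \<inter> ?D = {}"
    by (auto simp: increasing_edges_def decreasing_edges_def)
  have sub: "start_edges E \<subseteq> E" for E
    by (auto simp: start_edges_def)
  have fin: "finite (start_edges ?I)" "finite (start_edges ?D)"
    using sub finite_edges finite_subset by metis+
  have mI: "finite {es. maximal_path ?I es}" "card {es. maximal_path ?I es} = card (start_edges ?I)"
    using bij[of ?I] fin bij_betw_finite bij_betw_same_card by blast+
  have mD: "finite {es. maximal_path ?D es}" "card {es. maximal_path ?D es} = card (start_edges ?D)"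
    using bij[of ?D] fin bij_betw_finite bij_betw_same_card by blast+
  have "hd es \<in> E" if "maximal_path E es" for E es
    using that by (auto simp: maximal_path_def is_path_def)
  then have d: "{es. maximal_path ?I es} \<inter> {es. maximal_path ?D es} = {}"
    using disj by blast
  have "faces n \<pi> = {es. maximal_path ?I es} \<union> {es. maximal_path ?D es}"
    by (auto simp: faces_def)
  then have "card (faces n \<pi>) = card (start_edges ?I) + card (start_edges ?D)"
    using card_Un_disjoint[OF mI(1) mD(1) d] mI(2) mD(2) by simp
  also have "\<dots> = card (start_edges ?I \<union> start_edges ?D)"
    using sub[of ?I] sub[of ?D] disj fin by (subst card_Un_disjoint) auto
  finally show ?thesis .
qed

text \<open>Nothing enters position 1. At an interior position exactly one edge enters, and the
  leaving edge starts a face iff its direction differs; right-left minima only ascend, so this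
  happens on the source chain alone.\<close>

lemma start_edge_iff:
  assumes e: "edge_at i j"
  shows "(pt i, pt j) \<in> start_edges (increasing_edges n \<pi>) \<union> start_edges (decreasing_edges n \<pi>)
    \<longleftrightarrow> i = 1 \<or> i \<in> turns source_pos \<pi>"
proof -
  have "i \<noteq> j" using edge_at_less[OF e] by simp
  then have ne: "\<pi> i \<noteq> \<pi> j" by (simp add: perm_eq_iff)
  have inc: "(pt i, pt j) \<in> start_edges (increasing_edges n \<pi>) \<longleftrightarrow>
      \<pi> i < \<pi> j \<and> (\<forall>h. edge_at h i \<longrightarrow> \<not> \<pi> h < \<pi> i)"
    using e unfolding start_edges_def increasing_edges_eq by auto
  have dec: "(pt i, pt j) \<in> start_edges (decreasing_edges n \<pi>) \<longleftrightarrow>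
      \<pi> j < \<pi> i \<and> (\<forall>h. edge_at h i \<longrightarrow> \<not> \<pi> i < \<pi> h)"
    using e unfolding start_edges_def decreasing_edges_eq by auto
  have lt: "1 \<le> i" "i < j" "j \<le> n" using edge_at_less[OF e] by auto
  show ?thesis
  proof (cases "i = 1")
    case True
    then have "\<not> edge_at h i" for h using edge_at_less by fastforce
    then show ?thesis using True ne unfolding Un_iff inc dec by auto
  next
    case False
    then have i: "1 < i" "i < n" using lt by auto
    show ?thesis
    proof (cases "i \<in> source_pos")
      case True
      then obtain h where h: "adjacent_in source_pos h i"
        using adjacent_in_pred[of source_pos 1 i] i by auto
      have hu: "edge_at h' i \<longleftrightarrow> h' = h" for h'
        using edge_at_interior(2)[OF i True] h adjacent_in_unique_left by blast
      have j: "adjacent_in source_pos i j" using e edge_at_interior(1)[OF i True] by simp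
      have "i \<in> turns source_pos \<pi> \<longleftrightarrow> (\<pi> h < \<pi> i) \<noteq> (\<pi> i < \<pi> j)"
        unfolding turns_def using h j adjacent_in_unique_left adjacent_in_unique_right by blast
      moreover have "\<pi> h \<noteq> \<pi> i" using h by (auto simp: perm_eq_iff adjacent_in_def)
      ultimately show ?thesis
        using ne False by (auto simp: inc dec hu)
    next
      case r: False
      then have R: "i \<in> rlmin_pos" using pos_cover[of i] i by simp
      then obtain h where h: "adjacent_in rlmin_pos h i"
        using adjacent_in_pred[of rlmin_pos 1 i] i by auto
      have "\<pi> h < \<pi> i" "\<pi> i < \<pi> j"
        using h R lt by (auto simp: adjacent_in_def rlmin_pos_def)
      moreover have "edge_at h i" using h by (simp add: edge_at_def)
      moreover have "i \<notin> turns source_pos \<pi>" using r by (auto simp: turns_def adjacent_in_def)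
      ultimately show ?thesis using False by (auto simp: inc dec)
    qed
  qed
qed

text \<open>There is one face for each edge out of position 1 and one for each turn of the source
  chain; for \<open>3 \<le> n\<close> two edges leave position 1.\<close>

lemma card_faces_le_3_iff: "card (faces n \<pi>) \<le> 3 \<longleftrightarrow> card (turns source_pos \<pi>) \<le> 1"
proof -
  let ?Z = "start_edges (increasing_edges n \<pi>) \<union> start_edges (decreasing_edges n \<pi>)"
  define F where "F = {(pt 1, pt j) | j. edge_at 1 j}"
  define G where "G = {(pt i, pt j) | i j. edge_at i j \<and> i \<in> turns source_pos \<pi>}"
  have nt: "1 < i \<and> i < n" if "i \<in> turns source_pos \<pi>" for i
    using that pos_bounds(1) by (fastforce simp: turns_def adjacent_in_def)
  have "?Z \<subseteq> {(pt i, pt j) | i j. edge_at i j}"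
    by (auto simp: start_edges_def increasing_edges_eq decreasing_edges_eq)
  then have Z: "?Z = F \<union> G"
    using start_edge_iff unfolding F_def G_def by blast
  obtain r where r: "adjacent_in rlmin_pos 1 r"
    using adjacent_in_succ[of rlmin_pos n 1] two_le by auto
  obtain s where s: "adjacent_in source_pos 1 s"
    using adjacent_in_succ[of source_pos n 1] two_le by auto
  have "edge_at 1 j \<longleftrightarrow> j = r \<or> j = s" for j
    using r s adjacent_in_unique_right by (auto simp: edge_at_def)
  then have F: "F = {(pt 1, pt r), (pt 1, pt s)}"
    unfolding F_def by auto
  have tu: "\<exists>!j. edge_at i j" if i: "i \<in> turns source_pos \<pi>" for i
  proof -
    have "\<exists>j. edge_at i j" using i by (auto simp: turns_def edge_at_def)
    then show ?thesis using edge_at_unique_right nt[OF i] by blast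
  qed
  have "bij_betw (\<lambda>e. fst (fst e)) G (turns source_pos \<pi>)"
    unfolding bij_betw_def inj_on_def G_def using tu by (auto simp: image_iff) metis+
  then have G: "card G = card (turns source_pos \<pi>)" by (rule bij_betw_same_card)
  have fG: "finite G"
    using Z finite_edges by (metis (no_types, lifting) finite_Un finite_subset start_edges_def mem_Collect_eq subsetI)
  have fF: "finite F" unfolding F by simp
  have "F \<inter> G = {}" using nt by (auto simp: F_def G_def)
  then have card: "card (faces n \<pi>) = card F + card (turns source_pos \<pi>)"
    unfolding card_faces_eq Z using card_Un_disjoint[OF fF fG] G by simp
  show ?thesis
  \<comment> \<open>For \<open>n = 2\<close> no interior position exists, so there are no turns and
    both sides hold.\<close>
  proof (cases "n = 2")
    case True
    then have "turns source_pos \<pi> = {}" using nt by fastforce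
    moreover have "card F \<le> 2" unfolding F by (simp add: card_insert_if)
    ultimately show ?thesis using card by simp
  next
    case False
    then have n3: "3 \<le> n" using two_le by simp
    \<comment> \<open>A common successor of 1 on both chains could only be \<open>n\<close>, which
      would leave position 2 on neither chain.\<close>
    have "r \<noteq> s"
    proof
      assume "r = s"
      then have "r = n" using pos_disjoint[of r] r s by (auto simp: adjacent_in_def)
      then have "2 \<notin> rlmin_pos" "2 \<notin> source_pos"
        using r s \<open>r = s\<close> n3 by (auto simp: adjacent_in_def)
      then show False using pos_cover[of 2] n3 by simp
    qed
    then have "card F = 2" unfolding F by simp
    then show ?thesis using card by simp
  qed
qed

text \<open>The smaller entry at \<open>l\<close> is what makes \<open>i\<close> and
  \<open>j\<close> sources. The larger entry at \<open>k\<close> need not be a source, but the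
  largest entry behind \<open>j\<close> is one and can replace it.\<close>

lemma card_faces_le_3_iff_avoids:
  "card (faces n \<pi>) \<le> 3 \<longleftrightarrow>
    \<not> (\<exists>i\<in>{1..n}. \<exists>j\<in>{i<..n}. \<exists>k\<in>{j<..n}. \<exists>l\<in>{j<..n}. \<pi> j < \<pi> i \<and> \<pi> j < \<pi> k \<and> \<pi> l < \<pi> j)"
    (is "_ \<longleftrightarrow> \<not> ?Q")
proof -
  let ?S = source_pos
  let ?V = "\<exists>i\<in>?S. \<exists>j\<in>?S. \<exists>k\<in>?S. i < j \<and> j < k \<and> \<pi> j < \<pi> i \<and> \<pi> j < \<pi> k"
  have "card (turns ?S \<pi>) \<le> 1 \<longleftrightarrow> \<not> ?V"
  proof (rule card_turns_le_1_iff)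
    show "1 < x \<and> \<pi> 1 < \<pi> x" if "x \<in> ?S" "x \<noteq> 1" for x
      using that pos_bounds(1)[of x] one_less[of x] fixes_one by auto
  qed (simp_all add: inj_on_def perm_eq_iff)
  moreover have "?V \<longleftrightarrow> ?Q"
  proof
    assume ?V
    then obtain i j k where ijk: "i \<in> ?S" "j \<in> ?S" "k \<in> ?S" "i < j" "j < k" "\<pi> j < \<pi> i" "\<pi> j < \<pi> k"
      by blast
    then have b: "1 \<le> i" "k \<le> n" using pos_bounds by auto
    then have "j \<noteq> 1" "j \<noteq> n" using ijk by auto
    then obtain l where "l \<in> {j<..n}" "\<pi> l < \<pi> j" using ijk(2) by (auto simp: source_pos_def)
    moreover have "i \<in> {1..n}" "j \<in> {i<..n}" "k \<in> {j<..n}" using ijk b by auto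
    ultimately show ?Q using ijk by blast
  next
    assume ?Q
    then obtain i j k l where ijk: "i \<in> {1..n}" "j \<in> {i<..n}" "k \<in> {j<..n}" "l \<in> {j<..n}"
      "\<pi> j < \<pi> i" "\<pi> j < \<pi> k" "\<pi> l < \<pi> j" by blast
    have "Max (\<pi> ` {j<..n}) \<in> \<pi> ` {j<..n}" using ijk by (intro Max_in) auto
    then obtain k' where k': "k' \<in> {j<..n}" "\<pi> k' = Max (\<pi> ` {j<..n})" by auto
    have mx: "\<pi> x \<le> \<pi> k'" if "x \<in> {j<..n}" for x
      unfolding k'(2) using that by (intro Max_ge) auto
    have "k' \<in> ?S"
    \<comment> \<open>The maximum behind \<open>j\<close> is either the last entry or has the
      smaller last entry behind it.\<close>
    proof (cases "k' = n")
      case False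
      have "n \<in> {j<..n}" using k' by auto
      then have "\<pi> n \<le> \<pi> k'" by (rule mx)
      then have "\<pi> n < \<pi> k'" using False perm_eq_iff[of n k'] by auto
      then show ?thesis using False k' by (auto simp: source_pos_def)
    qed simp
    moreover have "i \<in> ?S" "j \<in> ?S" using ijk by (auto simp: source_pos_def)
    moreover have "\<pi> j < \<pi> k'" using mx[OF ijk(3)] ijk(6) by simp
    moreover have "i < j" "j < k'" using ijk k' by auto
    ultimately show ?V using ijk(5) by blast
  qed
  ultimately show ?thesis unfolding card_faces_le_3_iff by (simp only:)
qed

end

section \<open>Admissible words\<close>

primrec blockers :: "nat list \<Rightarrow> nat set" where
  "blockers [] = {}"
| "blockers (x # ys) =
     (if (\<exists>y\<in>set ys. y < x) \<and> (\<exists>y\<in>set ys. x < y) then {x} else {}) \<union> blockers ys"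

primrec unblocked :: "nat list \<Rightarrow> bool" where
  "unblocked [] \<longleftrightarrow> True"
| "unblocked (x # ys) \<longleftrightarrow> unblocked ys \<and> (\<forall>b\<in>blockers ys. x \<le> b)"

lemma blockers_subset: "blockers w \<subseteq> set w"
  by (induction w) auto

text \<open>The increasing map that skips the value \<open>a\<close>, making room for a new entry of
  rank \<open>a\<close>.\<close>

definition raise :: "nat \<Rightarrow> nat \<Rightarrow> nat" where
  "raise a x = (if x < a then x else Suc x)"

lemma strict_mono_raise: "strict_mono (raise a)"
  by (auto simp: strict_mono_def raise_def)

lemma blockers_map:
  assumes "strict_mono f"
  shows "blockers (map f w) = f ` blockers w"
  by (induction w) (auto simp: strict_mono_less[OF assms])

lemma unblocked_map:
  assumes "strict_mono f"
  shows "unblocked (map f w) \<longleftrightarrow> unblocked w"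
  by (induction w) (auto simp: blockers_map assms strict_mono_less_eq[OF assms])

definition words :: "nat \<Rightarrow> nat list set" where
  "words m = {w. length w = m \<and> set w = {1..m} \<and> unblocked w}"

lemma finite_words: "finite (words m)"
  by (rule finite_subset[OF _ finite_lists_length_eq[of "{1..m}" m]]) (auto simp: words_def)

definition ins :: "nat \<Rightarrow> nat list \<Rightarrow> nat list" where
  "ins a w = a # map (raise a) w"

lemma inj_raise: "inj (raise a)"
  by (simp add: strict_mono_imp_inj_on strict_mono_raise)

lemma inj_ins: "inj (ins a)"
  using inj_raise by (auto simp: inj_def ins_def inj_map_eq_map)

lemma raise_image:
  assumes "1 \<le> a" "a \<le> Suc m"
  shows "raise a ` {1..m} = {1..Suc m} - {a}"
proof (intro equalityI subsetI)
  fix y assume y: "y \<in> {1..Suc m} - {a}"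
  then have "y = raise a (if y < a then y else y - 1)"
    using assms by (auto simp: raise_def)
  moreover have "(if y < a then y else y - 1) \<in> {1..m}"
    using y assms by auto
  ultimately show "y \<in> raise a ` {1..m}" by blast
qed (use assms in \<open>auto simp: raise_def split: if_splits\<close>)

text \<open>Raising preserves order and does not change which values are at least \<open>a\<close>,
  so a new first entry can be tested against the blockers before they are shifted.\<close>

lemma ins_in_words_iff:
  assumes "1 \<le> a" "a \<le> Suc m" "length w = m" "set w = {1..m}"
  shows "ins a w \<in> words (Suc m) \<longleftrightarrow> w \<in> words m \<and> (\<forall>b\<in>blockers w. a \<le> b)"
proof -
  have "insert a (raise a ` {1..m}) = {1..Suc m}"
    using assms(1,2) unfolding raise_image[OF assms(1,2)] by auto
  moreover have "a \<le> raise a b \<longleftrightarrow> a \<le> b" for b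
    by (auto simp: raise_def)
  ultimately show ?thesis
    using assms unfolding words_def ins_def
    by (simp add: unblocked_map blockers_map strict_mono_raise)
qed

text \<open>Old blockers survive an order-preserving shift; the new entry has 1 below it iff
  \<open>1 < a\<close> and \<open>Suc m\<close> above it iff \<open>a \<le> m\<close>.\<close>

lemma blockers_ins:
  assumes "1 \<le> a" "a \<le> Suc m" "set w = {1..m}"
  shows "blockers (ins a w) = (if 1 < a \<and> a \<le> m then {a} else {}) \<union> raise a ` blockers w"
proof -
  have "(\<exists>y\<in>raise a ` {1..m}. y < a) \<longleftrightarrow> 1 < a"
    using assms unfolding raise_image[OF assms(1,2)] by (auto intro!: bexI[of _ 1])
  moreover have "(\<exists>y\<in>raise a ` {1..m}. a < y) \<longleftrightarrow> a \<le> m"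
    using assms unfolding raise_image[OF assms(1,2)] by (auto intro!: bexI[of _ "Suc m"])
  ultimately show ?thesis
    using assms(3) by (simp add: ins_def blockers_map strict_mono_raise)
qed

lemma ins_cases:
  assumes "length w = Suc m" "set w = {1..Suc m}"
  obtains a w' where "w = ins a w'" "1 \<le> a" "a \<le> Suc m" "length w' = m" "set w' = {1..m}"
proof -
  obtain a u where w: "w = a # u" and u: "length u = m"
    using assms by (metis length_Suc_conv)
  have "distinct w" using assms by (metis card_atLeastAtMost card_distinct diff_Suc_1)
  then have su: "set u = {1..Suc m} - {a}" using assms w by auto
  have a: "1 \<le> a" "a \<le> Suc m" using assms w by auto
  then have "set u = raise a ` {1..m}" using su raise_image by simp
  then have "\<forall>x\<in>set u. \<exists>y\<in>{1..m}. x = raise a y" by auto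
  \<comment> \<open>\<open>g\<close> undoes \<open>raise a\<close> on the tail, closing the gap left
    by the deleted first entry.\<close>
  then obtain g where g: "\<forall>x\<in>set u. g x \<in> {1..m} \<and> x = raise a (g x)" by metis
  have "w = ins a (map g u)"
    using g by (auto simp: w ins_def map_idI)
  moreover have "set (map g u) = {1..m}"
  proof -
    have "raise a ` set (map g u) = raise a ` {1..m}"
      using g su a raise_image by (force simp: image_image)
    then show ?thesis using inj_raise by (simp add: inj_image_eq_iff)
  qed
  ultimately show thesis using that a u by simp
qed

text \<open>This is \<open>F m c\<close> of the overview. For \<open>1 \<le> c\<close> and
  \<open>c \<le> Suc m\<close> it also counts the admissible words of length \<open>Suc m\<close>
  that start with \<open>c\<close>.\<close>

definition free_count :: "nat \<Rightarrow> nat \<Rightarrow> nat" where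
  "free_count m c = card {w \<in> words m. \<forall>b\<in>blockers w. c \<le> b}"

lemma card_words_hd:
  assumes "1 \<le> a" "a \<le> Suc m"
  shows "card {w \<in> words (Suc m). hd w = a} = free_count m a"
proof -
  have "{w \<in> words (Suc m). hd w = a} = ins a ` {w \<in> words m. \<forall>b\<in>blockers w. a \<le> b}"
    (is "?L = ?R")
  proof (intro equalityI subsetI)
    fix w assume w: "w \<in> ?L"
    then obtain a' w' where *: "w = ins a' w'" "1 \<le> a'" "a' \<le> Suc m" "length w' = m" "set w' = {1..m}"
      by (auto simp: words_def elim: ins_cases)
    moreover have "a' = a" using w * by (simp add: ins_def)
    ultimately show "w \<in> ?R"
      using w ins_in_words_iff[of a' m w'] by auto
  next
    fix w assume "w \<in> ?R"
    then obtain w' where "w = ins a w'" "w' \<in> words m" "\<forall>b\<in>blockers w'. a \<le> b" by blast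
    then show "w \<in> ?L"
      using ins_in_words_iff[OF assms, of w'] by (auto simp: words_def ins_def)
  qed
  then show ?thesis
    by (simp add: free_count_def card_image inj_on_subset[OF inj_ins])
qed

section \<open>The recurrence for the counts and its solution\<close>

lemma blockers_word_bounds:
  assumes "w \<in> words m" "b \<in> blockers w"
  shows "1 \<le> b" "b \<le> m"
  using assms blockers_subset[of w] by (auto simp: words_def)

text \<open>Covers the index \<open>c - 1\<close> of the recurrence at \<open>c = 1\<close>.\<close>

lemma free_count_0: "free_count m 0 = free_count m 1"
  unfolding free_count_def using blockers_word_bounds(1)
  by (intro arg_cong[where f = card]) auto

lemma free_count_words: "free_count m 1 = card (words m)"
  unfolding free_count_def using blockers_word_bounds(1)
  by (intro arg_cong[where f = card]) auto

text \<open>Classify by the first entry \<open>a\<close>. For \<open>a = 1\<close> all blockers move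
  up by one; for \<open>2 \<le> a \<le> m\<close> the entry \<open>a\<close> becomes the least
  blocker, so only \<open>c \<le> a\<close> matters; for \<open>a = Suc m\<close> the tail has no
  blocker and none arises.\<close>

lemma free_count_rec:
  assumes "1 \<le> m" "1 \<le> c"
  shows "free_count (Suc m) c = free_count m (c - 1)
    + (\<Sum>a\<in>{a\<in>{2..m}. c \<le> a}. free_count m a) + free_count m (Suc m)"
proof -
  define X where "X a = {w \<in> words m. (\<forall>b\<in>blockers w. a \<le> b) \<and>
    (\<forall>b\<in>blockers (ins a w). c \<le> b)}" for a
  have "{w \<in> words (Suc m). \<forall>b\<in>blockers w. c \<le> b} = (\<Union>a\<in>{1..Suc m}. ins a ` X a)"
    (is "?L = ?R")
  proof (intro equalityI subsetI)
    fix w assume w: "w \<in> ?L"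
    then obtain a' w' where *: "w = ins a' w'" "1 \<le> a'" "a' \<le> Suc m" "length w' = m" "set w' = {1..m}"
      by (auto simp: words_def elim: ins_cases)
    then show "w \<in> ?R"
      using w ins_in_words_iff[of a' m w'] by (auto simp: X_def)
  next
    fix w assume "w \<in> ?R"
    then obtain a w' where "w = ins a w'" "w' \<in> X a" "1 \<le> a" "a \<le> Suc m" by auto
    then show "w \<in> ?L"
      using ins_in_words_iff[of a m w'] by (auto simp: words_def X_def)
  qed
  moreover have "card (\<Union>a\<in>{1..Suc m}. ins a ` X a) = (\<Sum>a\<in>{1..Suc m}. card (ins a ` X a))"
    by (intro card_UN_disjoint) (auto simp: X_def finite_words ins_def)
  moreover have "card (ins a ` X a) = card (X a)" for a
    by (simp add: card_image inj_on_subset[OF inj_ins])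
  ultimately have "free_count (Suc m) c = (\<Sum>a\<in>{1..Suc m}. card (X a))"
    by (simp add: free_count_def)
  \<comment> \<open>Since \<open>1 \<le> m\<close>, the extreme ranks 1 and \<open>Suc m\<close> are
    distinct.\<close>
  also have "{1..Suc m} = insert 1 (insert (Suc m) {2..m})"
    using assms by auto
  also have "(\<Sum>a\<in>insert 1 (insert (Suc m) {2..m}). card (X a)) =
      card (X 1) + (\<Sum>a=2..m. card (X a)) + card (X (Suc m))"
    using assms by simp
  also have "X 1 = {w \<in> words m. \<forall>b\<in>blockers w. c - 1 \<le> b}"
  proof -
    have "(\<forall>b\<in>blockers (ins 1 w). c \<le> b) \<longleftrightarrow> (\<forall>b\<in>blockers w. c - 1 \<le> b)" if w: "w \<in> words m" for w
    proof -
      have "raise 1 b = Suc b" if "b \<in> blockers w" for b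
        using blockers_word_bounds(1)[OF w that] by (simp add: raise_def)
      then have "raise 1 ` blockers w = Suc ` blockers w" by (rule image_cong[OF refl])
      then have "blockers (ins 1 w) = Suc ` blockers w"
        using w blockers_ins[of 1 m w] by (simp add: words_def)
      then show ?thesis by auto
    qed
    then show ?thesis using blockers_word_bounds(1) by (auto simp: X_def)
  qed
  also have "card \<dots> = free_count m (c - 1)" by (simp add: free_count_def)
  \<comment> \<open>Blockers of a word of length \<open>m\<close> are at most \<open>m\<close>, so
    this threshold leaves only words without blockers.\<close>
  also have "X (Suc m) = {w \<in> words m. \<forall>b\<in>blockers w. Suc m \<le> b}"
  proof -
    have "blockers (ins (Suc m) w) = {}" if "w \<in> words m" "\<forall>b\<in>blockers w. Suc m \<le> b" for w
    proof -
      have "blockers w = {}" using blockers_word_bounds(2)[OF that(1)] that(2) by fastforce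
      then show ?thesis using that blockers_ins[of "Suc m" m w] by (simp add: words_def)
    qed
    then show ?thesis by (auto simp: X_def)
  qed
  also have "card \<dots> = free_count m (Suc m)" by (simp add: free_count_def)
  also have "(\<Sum>a=2..m. card (X a)) = (\<Sum>a=2..m. if c \<le> a then free_count m a else 0)"
  proof (rule sum.cong)
    fix a assume a: "a \<in> {2..m}"
    have "X a = (if c \<le> a then {w \<in> words m. \<forall>b\<in>blockers w. a \<le> b} else {})"
    proof -
      have "(\<forall>b\<in>blockers (ins a w). c \<le> b) \<longleftrightarrow> c \<le> a"
        if "w \<in> words m" "\<forall>b\<in>blockers w. a \<le> b" for w
      proof -
        have "blockers (ins a w) = insert a (raise a ` blockers w)"
          using a that blockers_ins[of a m w] by (simp add: words_def)
        moreover have "a \<le> raise a b" if "b \<in> blockers w" for b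
          using that \<open>\<forall>b\<in>blockers w. a \<le> b\<close> by (simp add: raise_def)
        ultimately show ?thesis by (auto intro: order_trans)
      qed
      then show ?thesis by (auto simp: X_def)
    qed
    then show "card (X a) = (if c \<le> a then free_count m a else 0)"
      by (simp add: free_count_def)
  qed simp
  also have "\<dots> = (\<Sum>a\<in>{a\<in>{2..m}. c \<le> a}. free_count m a)"
    by (subst sum.inter_filter) auto
  finally show ?thesis .
qed

lemma words_0: "words 0 = {[]}"
  by (auto simp: words_def)

lemma words_1: "words (Suc 0) = {[Suc 0]}"
proof (intro equalityI subsetI)
  fix w assume "w \<in> words (Suc 0)"
  then have "length w = Suc 0" and s: "set w = {Suc 0}" by (auto simp: words_def)
  then obtain x where "w = [x]" by (auto simp: length_Suc_conv)
  with s show "w \<in> {[Suc 0]}" by simp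
qed (simp add: words_def)

lemma free_count_base: "free_count 0 c = 1" "free_count (Suc 0) c = 1"
proof -
  have "{w \<in> words 0. \<forall>b\<in>blockers w. c \<le> b} = {[]}"
    unfolding words_0 by force
  moreover have "{w \<in> words (Suc 0). \<forall>b\<in>blockers w. c \<le> b} = {[Suc 0]}"
    unfolding words_1 by force
  ultimately show "free_count 0 c = 1" "free_count (Suc 0) c = 1"
    by (simp_all add: free_count_def)
qed

text \<open>Subtract the recurrence at \<open>Suc c\<close> from the one at \<open>c\<close>: the
  additional summand \<open>a = c\<close> cancels the leading term
  \<open>free_count m c\<close>.\<close>

lemma free_count_diff:
  assumes "2 \<le> c" "c \<le> m"
  shows "free_count (Suc m) c = free_count (Suc m) (Suc c) + free_count m (c - 1)"
proof -
  have "{a\<in>{2..m}. c \<le> a} = insert c {a\<in>{2..m}. Suc c \<le> a}" using assms by auto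
  then show ?thesis using assms by (simp add: free_count_rec)
qed

text \<open>The least entry is never a blocker. In the recurrence the sums agree because they start
  at 2, and the leading terms agree by \<open>free_count_0\<close>.\<close>

lemma free_count_1_2: "1 \<le> m \<Longrightarrow> free_count m 1 = free_count m 2"
proof (cases "m = 1")
  case False
  assume "1 \<le> m"
  with False obtain k where k: "m = Suc k" "1 \<le> k" by (cases m) auto
  have "{a\<in>{2..k}. 1 \<le> a} = {a\<in>{2..k}. 2 \<le> a}" by auto
  then show ?thesis using k by (simp add: free_count_rec free_count_0)
qed (simp add: free_count_base)

text \<open>The greatest entry is never a blocker, so both numbers count words without blockers, in
  which each prepended entry is the least or the greatest. In the recurrence the middle sum is
  empty.\<close>

lemma free_count_top: "free_count (Suc m) (Suc m) = 2 ^ m \<and> free_count (Suc m) (Suc (Suc m)) = 2 ^ m"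
proof (induction m)
  case 0
  then show ?case by (simp add: free_count_base)
next
  case (Suc m)
  have "{a\<in>{2..Suc m}. Suc (Suc m) \<le> a} = {}" "{a\<in>{2..Suc m}. Suc (Suc (Suc m)) \<le> a} = {}" by auto
  with Suc show ?case by (simp add: free_count_rec[of "Suc m"])
qed

text \<open>Pascal's rule splits the window into two overlapping windows of the row below; moving
  the top term \<open>N choose p\<close> from one to the other gives the two symmetric windows on
  the right.\<close>

lemma binomial_window_diff:
  fixes p k :: nat
  assumes "1 \<le> k" "k < p"
  shows "(\<Sum>i=p-k..p. (2*p-k) choose i) =
    (\<Sum>i=p-Suc k..p. (2*p-Suc k) choose i) + (\<Sum>i=(p-1)-(k-1)..p-1. (2*(p-1)-(k-1)) choose i)"
proof -
  define N where "N = 2 * p - Suc k"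
  define q where "q = p - Suc k"
  have q: "p - k = Suc q" "2 * p - k = Suc N" "q \<le> p" "(p-1)-(k-1) = Suc q" "2*(p-1)-(k-1) = N"
    "N = p + q" "Suc q \<le> p" "p - Suc k = q"
    using assms by (auto simp: N_def q_def)
  obtain p' where p': "p = Suc p'" using assms by (cases p) auto
  have qp: "q \<le> p'" using q p' by simp
  have "(\<Sum>i=Suc q..p. Suc N choose i) = (\<Sum>i=q..p'. Suc N choose Suc i)"
    unfolding p' by (rule sum.shift_bounds_cl_Suc_ivl)
  also have "\<dots> = (\<Sum>i=q..p'. N choose i) + (\<Sum>i=q..p'. N choose Suc i)"
    by (simp add: sum.distrib)
  also have "(\<Sum>i=q..p'. N choose Suc i) = (\<Sum>i=Suc q..p. N choose i)"
    unfolding p' by (rule sum.shift_bounds_cl_Suc_ivl[symmetric])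
  also have "\<dots> = (N choose p) + (\<Sum>i=Suc q..p'. N choose i)"
    using q p' by simp
  also have "(\<Sum>i=q..p'. N choose i) + ((N choose p) + (\<Sum>i=Suc q..p'. N choose i)) =
      (\<Sum>i=q..p. N choose i) + (\<Sum>i=Suc q..p'. N choose i)"
    using qp p' by simp
  finally show ?thesis
    unfolding q N_def[symmetric] using p' by simp
qed

text \<open>By Pascal's rule the two middle entries of an odd row add up to the central entry below
  them, so the windows for \<open>k = 1\<close> and \<open>k = 0\<close> have the same sum.\<close>

lemma binomial_window_1:
  assumes "1 \<le> (p::nat)"
  shows "(\<Sum>i=p-1..p. (2*p-1) choose i) = (2*p) choose p"
proof -
  obtain r where "p = Suc r" using assms by (cases p) auto
  then show ?thesis by simp
qed

text \<open>
  For \<open>m = p + 1\<close> and \<open>c = k + 1\<close> the binomial coefficients form a window symmetric about the middle of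
  row \<open>2 * p - k\<close>.
\<close>

lemma free_count_eq:
  "k \<le> p \<Longrightarrow> free_count (Suc p) (Suc k) = (\<Sum>i=p-k..p. (2*p-k) choose i)"
proof (induction p arbitrary: k)
  case 0
  then show ?case by (simp add: free_count_base)
next
  case (Suc p)
  note IH = Suc.IH
  \<comment> \<open>For fixed length, \<open>free_count_diff\<close> gives the values downwards in
    \<open>k\<close>, starting at \<open>k = Suc p\<close>, where the window is a whole row with sum
    \<open>2 ^ Suc p\<close>.\<close>
  have *: "free_count (Suc (Suc p)) (Suc k) = (\<Sum>i=Suc p-k..Suc p. (2*Suc p-k) choose i)"
    if "1 \<le> k" "k \<le> Suc p" for k
    using that(2,1)
  proof (induction k rule: inc_induct)
    case base
    have "(\<Sum>i=0..Suc p. Suc p choose i) = 2 ^ Suc p"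
      using choose_row_sum[of "Suc p"] by (simp only: atMost_atLeast0)
    then show ?case using free_count_top[of "Suc p"] by simp
  next
    case (step k)
    have "free_count (Suc (Suc p)) (Suc k) = free_count (Suc (Suc p)) (Suc (Suc k)) + free_count (Suc p) (Suc (k - 1))"
      using free_count_diff[of "Suc k" "Suc p"] step by simp
    also have "\<dots> = (\<Sum>i=Suc p-k..Suc p. (2*Suc p-k) choose i)"
      using step.IH step.hyps step.prems IH[of "k - 1"] binomial_window_diff[of k "Suc p"]
      by (simp del: sum.cl_ivl_Suc)
    finally show ?case .
  qed
  show ?case
  \<comment> \<open>The difference equation starts at threshold 2; threshold 1 has the same count by
    \<open>free_count_1_2\<close>.\<close>
  proof (cases "k = 0")
    case True
    then show ?thesis
      using *[of 1] free_count_1_2[of "Suc (Suc p)"] binomial_window_1[of "Suc p"]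
      by (simp add: numeral_2_eq_2)
  qed (use * Suc.prems in auto)
qed

lemma card_words: "card (words (Suc p)) = (2 * p) choose p"
  using free_count_eq[of 0 p] free_count_words[of "Suc p"] by simp

section \<open>Generating functions\<close>

text \<open>Summation by parts, which brings in the differences known from
  \<open>free_count_diff\<close>.\<close>

lemma one_minus_times_sum:
  fixes X :: "'a::comm_ring_1"
  shows "(1 - X) * (\<Sum>b\<le>M. f b * X ^ b) = f 0 + (\<Sum>b<M. (f (Suc b) - f b) * X ^ Suc b) - f M * X ^ Suc M"
  by (induction M) (simp_all add: algebra_simps)

text \<open>The kernel equation at \<open>x ^ (k + 4)\<close>. The differences of \<open>f\<close>
  vanish at both ends and otherwise cancel against \<open>g\<close>; what remains is
  \<open>f 0\<close>, the top term of \<open>f\<close> and the last two terms of \<open>g\<close>,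
  all powers of 2 except \<open>f 0\<close>.\<close>

lemma free_count_polynomial_identity:
  fixes X :: "'a::comm_ring_1"
  shows "(1 - X) * (\<Sum>b\<le>k+2. of_nat (free_count (k+2) (b+1)) * X ^ b)
      + X\<^sup>2 * (\<Sum>b\<le>k+1. of_nat (free_count (k+1) (b+1)) * X ^ b)
    = of_nat ((2*(k+1)) choose (k+1)) + 2 ^ k * (X ^ (k+2) - X ^ (k+3))"
proof -
  define f :: "nat \<Rightarrow> 'a" where "f b = of_nat (free_count (k+2) (b+1))" for b
  define g :: "nat \<Rightarrow> 'a" where "g b = of_nat (free_count (k+1) (b+1))" for b
  have f01: "f (Suc 0) = f 0"
    using free_count_1_2[of "k+2"] by (simp add: f_def numeral_2_eq_2)
  have fk: "f (Suc (Suc k)) = f (Suc k)" "f (Suc (Suc k)) = 2 * 2 ^ k"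
    using free_count_top[of "Suc k"] by (simp_all add: f_def)
  have gk: "g k = 2 ^ k" "g (Suc k) = 2 ^ k"
    using free_count_top[of k] by (simp_all add: g_def)
  have fg: "f (Suc (Suc b)) - f (Suc b) = - g b" if "b < k" for b
    using free_count_diff[of "Suc (Suc b)" "Suc k"] that by (simp add: f_def g_def)
  have f0: "f 0 = of_nat ((2*(k+1)) choose (k+1))"
    using free_count_words[of "k+2"] card_words[of "Suc k"] by (simp add: f_def)
  have "(\<Sum>b<k+2. (f (Suc b) - f b) * X ^ Suc b) = (\<Sum>b<Suc k. (f (Suc b) - f b) * X ^ Suc b)"
    using fk by simp
  also have "\<dots> = (\<Sum>b<k. (f (Suc (Suc b)) - f (Suc b)) * X ^ Suc (Suc b))"
    by (subst sum.lessThan_Suc_shift) (simp add: f01)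
  also have "\<dots> = - (\<Sum>b<k. X\<^sup>2 * (g b * X ^ b))"
    by (simp add: fg sum_negf power2_eq_square mult_ac)
  finally have 1: "(\<Sum>b<k+2. (f (Suc b) - f b) * X ^ Suc b) = - (X\<^sup>2 * (\<Sum>b<k. g b * X ^ b))"
    by (simp add: sum_distrib_left)
  have 2: "(\<Sum>b\<le>k+1. g b * X ^ b) = (\<Sum>b<k. g b * X ^ b) + 2 ^ k * X ^ k + 2 ^ k * X ^ (k+1)"
    using gk by (simp add: lessThan_Suc_atMost[symmetric])
  have "(1 - X) * (\<Sum>b\<le>k+2. f b * X ^ b) + X\<^sup>2 * (\<Sum>b\<le>k+1. g b * X ^ b)
      = f 0 + 2 ^ k * (X ^ (k+2) - X ^ (k+3))"
    unfolding one_minus_times_sum 1 2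
    by (simp add: fk(2) algebra_simps power2_eq_square power3_eq_cube power_add)
  then show ?thesis unfolding f0 unfolding f_def g_def .
qed

section \<open>The central binomial series\<close>

lemma gbinomial_minus_half:
  "((- 1 / 2 :: 'a::field_char_0) gchoose n) = (- 1 / 4) ^ n * of_nat ((2 * n) choose n)"
proof (induction n)
  case (Suc n)
  have c: "of_nat ((2 * k) choose k) = (fact (2 * k) :: 'a) / (fact k * fact k)" for k
    by (simp add: binomial_fact)
  have "((- 1 / 2 :: 'a) gchoose Suc n) = (- 1 / 2 gchoose n) * (- 1 / 2 - of_nat n) / of_nat (Suc n)"
    using gbinomial_mult_1[of "- 1 / 2 :: 'a" n] by (simp add: field_simps del: of_nat_Suc)
  also have "\<dots> = (- 1 / 4) ^ Suc n * of_nat ((2 * Suc n) choose Suc n)"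
    unfolding Suc c
    by (simp add: divide_simps del: of_nat_Suc) (simp add: algebra_simps)
  finally show ?case .
qed simp

text \<open>The coefficients are those of the binomial series with exponent -1/2 at -4x, so
  Vandermonde's identity gives the square exponent -1, that is, the coefficients
  \<open>4 ^ n\<close>.\<close>

lemma fps_central_binomial_square:
  "(Abs_fps (\<lambda>n. of_nat ((2 * n) choose n)) :: 'a::field_char_0 fps)\<^sup>2 * (1 - 4 * fps_X) = 1"
proof -
  define d :: "'a fps" where "d = Abs_fps (\<lambda>n. of_nat ((2 * n) choose n))"
  have d_nth: "d $ n = (- 4) ^ n * (- 1 / 2 gchoose n)" for n
    unfolding gbinomial_minus_half by (simp add: d_def power_mult_distrib[symmetric] mult.assoc[symmetric])
  have d2: "(d\<^sup>2) $ n = 4 ^ n" for n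
  proof -
    have "(d\<^sup>2) $ n = (\<Sum>i=0..n. (- 4) ^ n * ((- 1 / 2 gchoose i) * (- 1 / 2 gchoose (n - i))))"
      unfolding power2_eq_square fps_mult_nth d_nth
    proof (rule sum.cong)
      fix i assume "i \<in> {0..n}"
      then have "(- 4 :: 'a) ^ n = (- 4) ^ i * (- 4) ^ (n - i)"
        by (simp add: power_add[symmetric])
      then show "(- 4) ^ i * (- 1 / 2 gchoose i) * ((- 4) ^ (n - i) * (- 1 / 2 gchoose (n - i))) =
          (- 4 :: 'a) ^ n * ((- 1 / 2 gchoose i) * (- 1 / 2 gchoose (n - i)))"
        by (simp only: mult_ac)
    qed simp
    also have "\<dots> = (- 4) ^ n * ((- 1 / 2 + - 1 / 2) gchoose n)"
      unfolding gbinomial_Vandermonde[symmetric] sum_distrib_left ..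
    also have "\<dots> = 4 ^ n"
      by (simp add: gbinomial_minus[of 1, simplified] power_mult_distrib[symmetric] binomial_gbinomial[symmetric])
    finally show ?thesis .
  qed
  have "(d\<^sup>2 * (1 - fps_const 4 * fps_X)) $ n = (1 :: 'a fps) $ n" for n
    by (cases n) (simp_all add: right_diff_distrib d2 mult.assoc[symmetric]
        fps_mult_right_const_nth del: power_Suc, simp_all)
  then have "d\<^sup>2 * (1 - fps_const 4 * fps_X) = 1"
    by (simp add: fps_eq_iff)
  then show ?thesis by (simp add: d_def fps_numeral_fps_const)
qed

text \<open>The inverse of the central binomial series has constant term 1 and square
  \<open>1 - 4 * fps_X\<close>, which characterizes the selected root.\<close>

lemma fps_inverse_sqrt1:
  "1 / fps_sqrt1 (1 - 4 * fps_X :: 'a::field_char_0 fps) = Abs_fps (\<lambda>n. of_nat ((2 * n) choose n))"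
proof -
  define d :: "'a fps" where "d = Abs_fps (\<lambda>n. of_nat ((2 * n) choose n))"
  have d0: "d $ 0 = 1" by (simp add: d_def)
  have sq: "d\<^sup>2 * (1 - 4 * fps_X) = 1"
    unfolding d_def by (rule fps_central_binomial_square)
  have inv: "d * inverse d = 1"
    using inverse_mult_eq_1'[of d] d0 by simp
  have "(inverse d)\<^sup>2 = (inverse d)\<^sup>2 * (d\<^sup>2 * (1 - 4 * fps_X))"
    by (simp add: sq)
  also have "\<dots> = (d * inverse d)\<^sup>2 * (1 - 4 * fps_X)"
    by (simp only: power_mult_distrib mult_ac)
  finally have "(inverse d) ^ Suc 1 = 1 - 4 * fps_X"
    by (simp add: inv numeral_2_eq_2)
  moreover have "inverse d $ 0 = 1" by (simp add: d0)
  ultimately have "inverse d = fps_radical (\<lambda>_ _. 1) (Suc 1) (1 - 4 * fps_X)"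
    by (subst radical_unique[symmetric]) auto
  then have "fps_sqrt1 (1 - 4 * fps_X) = inverse d"
    by (simp add: fps_sqrt1_def numeral_2_eq_2)
  then have "1 / fps_sqrt1 (1 - 4 * fps_X) = inverse (inverse d)"
    using d0 by (simp add: fps_divide_unit)
  also have "\<dots> = d" using d0 by (simp add: fps_inverse_idempotent)
  finally show ?thesis by (simp add: d_def)
qed

lemma fps_geometric:
  fixes c :: "'a::field"
  shows "(1 - fps_const c * fps_X) * Abs_fps (\<lambda>n. c ^ n) = 1"
  by (rule fps_ext, case_tac n) (simp_all add: left_diff_distrib mult.assoc)

text \<open>The assumption \<open>tc\<close> separates the algebra from the combinatorics.
  Multiplying by the kernel \<open>K\<close> reduces the claim to the coefficient identities
  above.\<close>

lemma tri_gf_closed_form: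
  assumes tc: "\<And>n a. 2 \<le> a \<Longrightarrow> a \<le> n \<Longrightarrow> tri_count n a = free_count (n - 2) (a - 1)"
  shows "tri_gf = (var_x\<^sup>2 * (1 - var_v) * (1 - var_x * var_v)\<^sup>2)
        / ((1 - 2 * var_x * var_v) * (1 - var_v + var_x * var_v\<^sup>2))
      + var_x ^ 3 / (1 - var_v + var_x * var_v\<^sup>2) * (1 / fps_sqrt1 (1 - 4 * var_x))"
proof -
  let ?X = "fls_X :: rat fls"
  define K where "K = 1 - var_v + var_x * var_v\<^sup>2"
  define P where "P = 1 - 2 * var_x * var_v"
  define Q where "Q = Abs_fps (\<lambda>n. (2 * ?X) ^ n)"
  define d :: "rat fls fps" where "d = Abs_fps (\<lambda>n. of_nat ((2 * n) choose n))"
  have P_alt: "P = 1 - fps_const (2 * ?X) * fps_X"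
    by (simp add: P_def var_x_def var_v_def fps_const_mult[symmetric] fps_numeral_fps_const mult_ac
          del: fps_const_mult)
  have PQ: "P * Q = 1"
    unfolding P_alt Q_def by (rule fps_geometric)
  \<comment> \<open>The constant term of \<open>K\<close> in \<open>x\<close> is
    \<open>1 - ?X\<close>; nonzero in the field of Laurent series, it makes \<open>K\<close> a
    unit.\<close>
  have "?X \<noteq> 1"
    by (metis fls_X_nth fls_one_nth zero_neq_one)
  then have K0: "K $ 0 \<noteq> 0"
    by (simp add: K_def var_x_def var_v_def)
  have P0: "P $ 0 \<noteq> 0"
    by (simp add: P_alt)
  have sq: "1 / fps_sqrt1 (1 - 4 * var_x) = d"
    unfolding var_x_def d_def by (rule fps_inverse_sqrt1)
  have tn: "tri_gf $ (m + 2) = (\<Sum>b\<le>m. of_nat (free_count m (b+1)) * ?X ^ b)" for m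
  proof -
    have "tri_gf $ (m + 2) = (\<Sum>a=0+2..m+2. of_nat (tri_count (m+2) a) * ?X ^ (a - 2))"
      by (simp add: tri_gf_def numeral_2_eq_2 del: sum.cl_ivl_Suc)
    also have "\<dots> = (\<Sum>b=0..m. of_nat (tri_count (m+2) (b+2)) * ?X ^ b)"
      by (subst sum.shift_bounds_cl_nat_ivl) simp
    also have "\<dots> = (\<Sum>b\<le>m. of_nat (free_count m (b+1)) * ?X ^ b)"
      by (intro sum.cong) (auto simp: tc)
    finally show ?thesis .
  qed
  \<comment> \<open>Here \<open>d\<close> collects the central binomials and \<open>Q\<close> the
    powers of 2; the term without them comes from length 2.\<close>
  have "K * tri_gf = var_x\<^sup>2 * (1 - var_v) + var_x\<^sup>2 * (1 - var_v) * (var_x\<^sup>2 * var_v\<^sup>2 * Q) + var_x ^ 3 * d"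
    (is "_ = ?rhs")
  proof (rule fps_ext)
    fix n
    have K_alt: "K = fps_const (1 - ?X) + fps_X * fps_const (?X\<^sup>2)"
      by (simp add: K_def var_x_def var_v_def fps_const_power[symmetric] fps_const_sub[symmetric]
          del: fps_const_power fps_const_sub)
    have L: "(K * tri_gf) $ n = (1 - ?X) * tri_gf $ n + (if n = 0 then 0 else ?X\<^sup>2 * tri_gf $ (n - 1))"
      unfolding K_alt by (simp add: distrib_right mult.assoc)
    have rhs_alt: "?rhs = fps_X ^ 2 * fps_const (1 - ?X) + fps_X ^ 4 * (fps_const ((1 - ?X) * ?X\<^sup>2) * Q) + fps_X ^ 3 * d"
      by (simp add: var_x_def var_v_def fps_const_power[symmetric] fps_const_sub[symmetric] fps_const_mult[symmetric]
          mult_ac power_add[symmetric] del: fps_const_power fps_const_sub fps_const_mult)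
    have R: "?rhs $ n = (if n = 2 then 1 - ?X else 0) +
        (if n < 4 then 0 else (1 - ?X) * ?X\<^sup>2 * (2 * ?X) ^ (n - 4)) +
        (if n < 3 then 0 else of_nat ((2 * (n - 3)) choose (n - 3)))"
      unfolding rhs_alt by (simp add: fps_X_power_mult_nth Q_def d_def)
    \<comment> \<open>The polynomial identity applies from \<open>n = 4\<close> on, where both words
      involved are nonempty; smaller coefficients are computed directly.\<close>
    consider "n < 2" | "n = 2" | "n = 3" | "4 \<le> n" by linarith
    then show "(K * tri_gf) $ n = ?rhs $ n"
    proof cases
      case 1
      have "tri_gf $ n = 0" "tri_gf $ (n - 1) = 0" using 1 by (auto simp: tri_gf_def)
      then show ?thesis using 1 unfolding L R by simp
    next
      case 2
      have "tri_gf $ Suc 0 = 0" by (auto simp: tri_gf_def)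
      moreover have "tri_gf $ 2 = 1" using tn[of 0] by (simp add: free_count_base numeral_2_eq_2)
      ultimately show ?thesis unfolding L R unfolding 2 by simp
    next
      case 3
      have "tri_gf $ 2 = 1" using tn[of 0] by (simp add: free_count_base numeral_2_eq_2)
      moreover have "tri_gf $ 3 = 1 + ?X" using tn[of 1] by (simp add: free_count_base numeral_3_eq_3)
      ultimately show ?thesis unfolding L R unfolding 3 by (simp add: algebra_simps power2_eq_square)
    next
      case 4
      then obtain k where k: "n = k + 4" by (metis add.commute le_Suc_ex)
      have "(K * tri_gf) $ n = (1 - ?X) * tri_gf $ ((k + 2) + 2) + ?X\<^sup>2 * tri_gf $ ((k + 1) + 2)"
        unfolding L unfolding k by (simp add: numeral_eq_Suc)
      also have "\<dots> = of_nat ((2*(k+1)) choose (k+1)) + 2 ^ k * (?X ^ (k+2) - ?X ^ (k+3))"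
        unfolding tn by (rule free_count_polynomial_identity)
      also have "2 ^ k * (?X ^ (k+2) - ?X ^ (k+3)) = (1 - ?X) * ?X\<^sup>2 * (2 * ?X) ^ k"
        by (simp add: power_mult_distrib power_add algebra_simps power2_eq_square power3_eq_cube)
      finally show ?thesis unfolding R unfolding k by (simp add: numeral_eq_Suc)
    qed
  qed
  \<comment> \<open>Replacing 1 by \<open>P * Q\<close> makes \<open>Q\<close> a common factor, and
    its cofactor is then a perfect square.\<close>
  also have "\<dots> = var_x\<^sup>2 * (1 - var_v) * ((P + var_x\<^sup>2 * var_v\<^sup>2) * Q) + var_x ^ 3 * d"
    by (simp add: distrib_right distrib_left PQ)
  also have "P + var_x\<^sup>2 * var_v\<^sup>2 = (1 - var_x * var_v)\<^sup>2"
    by (simp add: P_def algebra_simps power2_eq_square)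
  finally have KT: "K * tri_gf = var_x\<^sup>2 * (1 - var_v) * ((1 - var_x * var_v)\<^sup>2 * Q) + var_x ^ 3 * d" .
  have iP: "inverse P = Q"
    using PQ fps_inverse_unique by metis
  have "tri_gf = inverse K * (K * tri_gf)"
    using K0 by (simp add: mult.assoc[symmetric] inverse_mult_eq_1)
  also have "\<dots> = (var_x\<^sup>2 * (1 - var_v) * (1 - var_x * var_v)\<^sup>2) * (Q * inverse K) + var_x ^ 3 * inverse K * d"
    unfolding KT by (simp add: algebra_simps)
  also have "Q * inverse K = inverse (P * K)"
    by (simp add: fps_inverse_mult iP)
  finally show ?thesis
    unfolding sq K_def[symmetric] P_def[symmetric]
    using K0 P0 by (simp add: fps_divide_unit)
qed

section \<open>Triangular permutations as words\<close>

lemma blockers_map_upt: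
  "blockers (map g [a..<c]) = {g j | j. a \<le> j \<and> j < c \<and>
    (\<exists>k. j < k \<and> k < c \<and> g j < g k) \<and> (\<exists>l. j < l \<and> l < c \<and> g l < g j)}"
proof (induction "c - a" arbitrary: a)
  case (Suc d)
  then have a: "a < c" "d = c - Suc a" by auto
  let ?P = "\<lambda>j. (\<exists>k. j < k \<and> k < c \<and> g j < g k) \<and> (\<exists>l. j < l \<and> l < c \<and> g l < g j)"
  have "(\<exists>y\<in>set (map g [Suc a..<c]). y < g a) \<longleftrightarrow> (\<exists>l. a < l \<and> l < c \<and> g l < g a)"
    "(\<exists>y\<in>set (map g [Suc a..<c]). g a < y) \<longleftrightarrow> (\<exists>k. a < k \<and> k < c \<and> g a < g k)"
    by (auto simp: Suc_le_eq)
  then have "blockers (map g [a..<c]) = (if ?P a then {g a} else {}) \<union> {g j | j. Suc a \<le> j \<and> j < c \<and> ?P j}"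
    using Suc(1)[OF a(2)] by (simp only: upt_conv_Cons[OF a(1)] list.map blockers.simps) (simp add: conj_commute)
  also have "\<dots> = {g j | j. a \<le> j \<and> j < c \<and> ?P j}"
    unfolding le_less[of a] Suc_le_eq using a(1) by auto
  finally show ?case .
qed simp

text \<open>Turns the list recursion into the four-index pattern that
  \<open>card_faces_le_3_iff_avoids\<close> excludes: \<open>j\<close> is the position of a blocker
  lying below an earlier entry at \<open>i\<close>.\<close>

lemma unblocked_map_upt:
  "unblocked (map g [a..<c]) \<longleftrightarrow> \<not> (\<exists>i j k l. a \<le> i \<and> i < j \<and> j < k \<and> k < c \<and> j < l \<and> l < c \<and>
    g j < g i \<and> g j < g k \<and> g l < g j)"
proof (induction "c - a" arbitrary: a)
  case (Suc d)
  then have a: "a < c" "d = c - Suc a" by auto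
  let ?P = "\<lambda>i. \<exists>j k l. i < j \<and> j < k \<and> k < c \<and> j < l \<and> l < c \<and> g j < g i \<and> g j < g k \<and> g l < g j"
  have "(\<forall>b\<in>blockers (map g [Suc a..<c]). g a \<le> b) \<longleftrightarrow> \<not> ?P a"
  proof
    assume L: "\<forall>b\<in>blockers (map g [Suc a..<c]). g a \<le> b"
    show "\<not> ?P a"
    proof
      assume "?P a"
      then obtain j k l where j: "a < j" "j < k" "k < c" "j < l" "l < c" "g j < g a" "g j < g k" "g l < g j"
        by blast
      moreover have "Suc a \<le> j" "j < c" using j by auto
      ultimately have "g j \<in> blockers (map g [Suc a..<c])"
        unfolding blockers_map_upt by blast
      then show False using L \<open>g j < g a\<close> by auto
    qed
  next
    assume R: "\<not> ?P a"
    show "\<forall>b\<in>blockers (map g [Suc a..<c]). g a \<le> b"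
    proof (rule ballI, rule leI, rule notI)
      fix b assume "b \<in> blockers (map g [Suc a..<c])" "b < g a"
      then obtain j k l where "b = g j" "Suc a \<le> j" "j < k" "k < c" "g j < g k" "j < l" "l < c" "g l < g j"
        unfolding blockers_map_upt by blast
      then show False using R \<open>b < g a\<close> by (metis Suc_le_eq)
    qed
  qed
  moreover have "unblocked (map g [Suc a..<c]) \<longleftrightarrow> \<not> (\<exists>i. a < i \<and> ?P i)"
    using Suc(1)[OF a(2)] by (simp add: Suc_le_eq)
  ultimately have "unblocked (map g [a..<c]) \<longleftrightarrow> \<not> (\<exists>i. a < i \<and> ?P i) \<and> \<not> ?P a"
    by (simp only: upt_conv_Cons[OF a(1)] list.map unblocked.simps)
  also have "\<dots> \<longleftrightarrow> \<not> (\<exists>i. a \<le> i \<and> ?P i)"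
    by (auto simp: le_less)
  finally show ?case by simp
qed auto

definition tail_word :: "nat \<Rightarrow> (nat \<Rightarrow> nat) \<Rightarrow> nat list" where
  "tail_word n \<pi> = map (\<lambda>i. \<pi> i - 1) [2..<Suc n]"

text \<open>Both sides exclude the same pattern: \<open>i = 1\<close> cannot occur in it, because
  \<pi> 1 = 1 exceeds no entry.\<close>

lemma triangular_iff_tail_word:
  assumes n: "2 \<le> n" and \<pi>: "\<pi> permutes {1..n}" "\<pi> 1 = 1"
  shows "triangular n \<pi> \<longleftrightarrow> tail_word n \<pi> \<in> words (n - 1)"
proof -
  interpret anchored_permutation n \<pi> using assms by unfold_locales
  have ge: "2 \<le> \<pi> i" if "2 \<le> i" "i \<le> n" for i using one_less[of i] that by simp
  have im: "\<pi> ` {2..n} = {2..n}"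
  proof -
    have "\<pi> ` ({1..n} - {1}) = {1..n} - {1}"
      using permutes_image[OF \<pi>(1)] permutes_inj[OF \<pi>(1)] \<pi>(2)
      by (simp add: image_set_diff)
    moreover have "{1..n} - {1} = {2..n}" by auto
    ultimately show ?thesis by simp
  qed
  have "set (tail_word n \<pi>) = (\<lambda>x. x - 1) ` (\<pi> ` {2..n})"
    by (simp add: tail_word_def image_image atLeastLessThanSuc_atLeastAtMost del: upt_Suc)
  also have "\<dots> = {1..n - 1}"
    unfolding im
  proof (intro equalityI subsetI)
    fix x assume "x \<in> {1..n - 1}"
    then have "x = Suc x - 1" "Suc x \<in> {2..n}" by auto
    then show "x \<in> (\<lambda>x. x - 1) ` {2..n}" by blast
  qed auto
  finally have st: "set (tail_word n \<pi>) = {1..n - 1}" .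
  have len: "length (tail_word n \<pi>) = n - 1" by (simp add: tail_word_def del: upt_Suc)
  \<comment> \<open>Entries behind the first are at least 2, so the truncated subtraction preserves
    their order.\<close>
  have less: "\<pi> i - 1 < \<pi> j - 1 \<longleftrightarrow> \<pi> i < \<pi> j" if "2 \<le> i" "i \<le> n" "2 \<le> j" "j \<le> n" for i j
    using ge[of i] ge[of j] that by linarith
  let ?Q = "\<lambda>i j k l. \<pi> j < \<pi> i \<and> \<pi> j < \<pi> k \<and> \<pi> l < \<pi> j"
  have "unblocked (tail_word n \<pi>) \<longleftrightarrow> \<not> (\<exists>i j k l. 2 \<le> i \<and> i < j \<and> j < k \<and> k < Suc n \<and> j < l \<and> l < Suc n \<and>
    \<pi> j - 1 < \<pi> i - 1 \<and> \<pi> j - 1 < \<pi> k - 1 \<and> \<pi> l - 1 < \<pi> j - 1)"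
    unfolding tail_word_def by (rule unblocked_map_upt)
  also have "\<dots> \<longleftrightarrow> \<not> (\<exists>i j k l. 2 \<le> i \<and> i < j \<and> j < k \<and> k < Suc n \<and> j < l \<and> l < Suc n \<and> ?Q i j k l)"
    by (intro arg_cong[where f = Not] ex_cong1 conj_cong refl) (auto simp: less[simplified])
  also have "\<dots> \<longleftrightarrow> \<not> (\<exists>i\<in>{1..n}. \<exists>j\<in>{i<..n}. \<exists>k\<in>{j<..n}. \<exists>l\<in>{j<..n}. ?Q i j k l)"
  proof (rule arg_cong[where f = Not], rule iffI)
    assume "\<exists>i j k l. 2 \<le> i \<and> i < j \<and> j < k \<and> k < Suc n \<and> j < l \<and> l < Suc n \<and> ?Q i j k l"
    then obtain i j k l where *: "2 \<le> i" "i < j" "j < k" "k < Suc n" "j < l" "l < Suc n" "?Q i j k l" by blast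
    then have "i \<in> {1..n}" "j \<in> {i<..n}" "k \<in> {j<..n}" "l \<in> {j<..n}" by auto
    with *(7) show "\<exists>i\<in>{1..n}. \<exists>j\<in>{i<..n}. \<exists>k\<in>{j<..n}. \<exists>l\<in>{j<..n}. ?Q i j k l" by blast
  next
    assume "\<exists>i\<in>{1..n}. \<exists>j\<in>{i<..n}. \<exists>k\<in>{j<..n}. \<exists>l\<in>{j<..n}. ?Q i j k l"
    then obtain i j k l where *: "i \<in> {1..n}" "j \<in> {i<..n}" "k \<in> {j<..n}" "l \<in> {j<..n}" "?Q i j k l" by blast
    have "1 < \<pi> j" using one_less[of j] *(1,2) by auto
    then have "i \<noteq> 1" using *(5) \<pi>(2) by auto
    then have "2 \<le> i" "i < j" "j < k" "k < Suc n" "j < l" "l < Suc n" using * by auto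
    with *(5) show "\<exists>i j k l. 2 \<le> i \<and> i < j \<and> j < k \<and> k < Suc n \<and> j < l \<and> l < Suc n \<and> ?Q i j k l" by blast
  qed
  also have "\<dots> \<longleftrightarrow> card (faces n \<pi>) \<le> 3"
    using card_faces_le_3_iff_avoids by simp
  finally show ?thesis
    using st len \<pi> by (simp add: triangular_def words_def)
qed

lemma bij_betw_tail_word:
  assumes n: "2 \<le> n"
  shows "bij_betw (tail_word n) {\<pi>. triangular n \<pi>} (words (n - 1))"
  unfolding bij_betw_def
proof (intro conjI equalityI subsetI)
  have tri: "\<pi> permutes {1..n}" "\<pi> 1 = 1" if "triangular n \<pi>" for \<pi>
    using that by (auto simp: triangular_def)
  show "inj_on (tail_word n) {\<pi>. triangular n \<pi>}"
  proof (rule inj_onI)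
    fix \<pi> \<sigma> assume "\<pi> \<in> {\<pi>. triangular n \<pi>}" "\<sigma> \<in> {\<pi>. triangular n \<pi>}" and eq: "tail_word n \<pi> = tail_word n \<sigma>"
    then have t: "triangular n \<pi>" "triangular n \<sigma>" by auto
    show "\<pi> = \<sigma>"
    proof
      fix i
      \<comment> \<open>The word fixes the values on \<open>{2..n}\<close>; both permutations fix 1
        and everything outside \<open>{1..n}\<close>.\<close>
      consider "i = 1" | "i \<in> {2..n}" | "i \<notin> {1..n}" by fastforce
      then show "\<pi> i = \<sigma> i"
      proof cases
        case 2
        have "\<pi> i - 1 = \<sigma> i - 1"
          using eq 2 by (auto simp: tail_word_def simp del: upt_Suc)
        moreover have "1 \<le> \<pi> i" "1 \<le> \<sigma> i"
          using permutes_in_image[OF tri(1)[OF t(1)], of i] permutes_in_image[OF tri(1)[OF t(2)], of i] 2 by auto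
        ultimately show ?thesis by linarith
      qed (use tri[OF t(1)] tri[OF t(2)] in \<open>auto simp: permutes_not_in\<close>)
    qed
  qed
  show "w \<in> words (n - 1)" if "w \<in> tail_word n ` {\<pi>. triangular n \<pi>}" for w
    using that triangular_iff_tail_word[OF n] tri by auto
  show "w \<in> tail_word n ` {\<pi>. triangular n \<pi>}" if w: "w \<in> words (n - 1)" for w
  proof -
    \<comment> \<open>The preimage of \<open>w\<close>: its letters raised by one behind a leading
      1, with the identity outside \<open>{1..n}\<close>.\<close>
    define \<pi> where "\<pi> i = (if i \<in> {2..n} then w ! (i - 2) + 1 else i)" for i
    have len: "length w = n - 1" and st: "set w = {1..n - 1}" using w by (auto simp: words_def)
    then have dist: "distinct w" by (simp add: card_distinct)
    have rng: "\<pi> i \<in> {2..n}" if "i \<in> {2..n}" for i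
    proof -
      have "w ! (i - 2) \<in> set w" using that len by (intro nth_mem) auto
      then show ?thesis using that st by (auto simp: \<pi>_def)
    qed
    have one: "\<pi> 1 = 1" by (simp add: \<pi>_def)
    have into: "\<pi> i \<in> {1..n}" if "i \<in> {1..n}" for i
      using that rng[of i] one by (cases "i = 1") auto
    have "inj_on \<pi> {1..n}"
    proof (rule inj_onI)
      fix i j assume ij: "i \<in> {1..n}" "j \<in> {1..n}" "\<pi> i = \<pi> j"
      show "i = j"
      proof (cases "i = 1 \<or> j = 1")
        case True
        then show ?thesis using ij rng[of i] rng[of j] one by (cases "i = 1"; cases "j = 1") auto
      next
        case False
        then have r: "i \<in> {2..n}" "j \<in> {2..n}" using ij by auto
        then have "w ! (i - 2) = w ! (j - 2)" using ij(3) by (simp add: \<pi>_def)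
        moreover have "i - 2 < length w" "j - 2 < length w" using r len by auto
        ultimately have "i - 2 = j - 2" using dist nth_eq_iff_index_eq by blast
        then show ?thesis using r by auto
      qed
    qed
    moreover have "\<pi> ` {1..n} \<subseteq> {1..n}" using into by blast
    ultimately have "bij_betw \<pi> {1..n} {1..n}"
      using endo_inj_surj[of "{1..n}" \<pi>] by (simp add: bij_betw_def)
    then have perm: "\<pi> permutes {1..n}"
      by (rule bij_imp_permutes) (auto simp: \<pi>_def)
    have tw: "tail_word n \<pi> = w"
    proof (rule nth_equalityI)
      fix i assume "i < length (tail_word n \<pi>)"
      then have "i < n - 1" by (simp add: tail_word_def del: upt_Suc)
      then show "tail_word n \<pi> ! i = w ! i" by (simp add: tail_word_def \<pi>_def del: upt_Suc)
    qed (simp add: tail_word_def len del: upt_Suc)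
    then have "triangular n \<pi>" using triangular_iff_tail_word[OF n perm one] w by simp
    then show ?thesis using tw by blast
  qed
qed

text \<open>The entry \<pi> 2 is one more than the head of the tail word, so the count is that of
  words of length \<open>n - 1\<close> with a given head.\<close>

lemma tri_count_eq:
  assumes "2 \<le> a" "a \<le> n"
  shows "tri_count n a = free_count (n - 2) (a - 1)"
proof -
  have n: "2 \<le> n" "n - 1 = Suc (n - 2)" using assms by auto
  have hd: "hd (tail_word n \<pi>) = \<pi> 2 - 1" for \<pi>
    using n by (simp add: tail_word_def hd_map upt_conv_Cons del: upt_Suc)
  let ?T = "{\<pi>. triangular n \<pi> \<and> \<pi> 1 = 1 \<and> \<pi> 2 = a}"
  have T: "?T = {\<pi> \<in> {\<pi>. triangular n \<pi>}. hd (tail_word n \<pi>) = a - 1}"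
    unfolding hd using assms by (auto simp: triangular_def)
  have "tail_word n ` ?T = {w \<in> words (n - 1). hd w = a - 1}"
    using bij_betw_tail_word[OF n(1)] unfolding T bij_betw_def by auto
  moreover have "inj_on (tail_word n) ?T"
    using bij_betw_tail_word[OF n(1)] unfolding bij_betw_def by (auto intro: inj_on_subset)
  then have "card (tail_word n ` ?T) = card ?T" by (rule card_image)
  ultimately have "tri_count n a = card {w \<in> words (n - 1). hd w = a - 1}"
    by (simp only: tri_count_def)
  also have "\<dots> = free_count (n - 2) (a - 1)"
    unfolding n(2) using assms by (intro card_words_hd) auto
  finally show ?thesis .
qed

theorem theorem4p1:
  shows "(\<forall>n. card {\<pi>. triangular (n + 2) \<pi>} = (2 * n) choose n) \<and>
    (let v = var_v; x = var_x in
      tri_gf =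
        (x\<^sup>2 * (1 - v) * (1 - x * v)\<^sup>2) / ((1 - 2 * x * v) * (1 - v + x * v\<^sup>2))
        + x ^ 3 / (1 - v + x * v\<^sup>2) * (1 / fps_sqrt1 (1 - 4 * x)))"
proof (intro conjI allI)
  fix n
  have "card {\<pi>. triangular (n + 2) \<pi>} = card (words (Suc n))"
    using bij_betw_same_card[OF bij_betw_tail_word[of "n + 2"]] by simp
  then show "card {\<pi>. triangular (n + 2) \<pi>} = (2 * n) choose n"
    by (simp add: card_words)
qed (simp only: Let_def tri_gf_closed_form[OF tri_count_eq])

end
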